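(* Let $M,N:ZZ\times\mathbb{Z}\to\mathbf{vec}$ be extended zigzag modules. Then $$d_\lambda^\infty(M,N)\leq d_I(M,N),$$ where $d_\lambda^\infty$ is the $\infty$-landscape distance and $d_I$ is the interleaving distance of extended zigzag modules.
   Context: $\mathbf{vec}$ is the category of finite-dimensional vector spaces over a fixed field $\mathbb{F}$. For posets $P$, $\mathbf{vec}^P$ is the category of functors $P\to\mathbf{vec}$. **The poset.** $ZZ$ is the set $\mathbb{Z}$ with the zigzag partial order: $a\le a'$ iff $a=a'$, or $a$ is odd and $|a-a'|=1$. Odd integers are called source indices and even integers sink indices. $ZZ\times\mathbb{Z}$ has the product order, with the usual order on $\mathbb{Z}$. An extended zigzag module is a functor $M:ZZ\times\mathbb{Z}\to\mathbf{vec}$. Standing assumption: $M$ has no infinite indecomposable direct summands (indecomposables with infinite support), so that the landscapes below take real values. **Generalized rank.** An interval $I$ of a poset $P$ is a nonempty subset that is convex ($p,q\in I$, $p\le r\le q$ implies $r\in I$) and connected (any two elements are joined by a finite sequence in $I$ whose consecutive elements are comparable). For $M:P\to\mathbf{vec}$ let $\varprojlim M|_I$ with projections $\pi_p$ and $\varinjlim M|_I$ with maps $i_p$ be the limit and colimit of the restriction. The map $\psi_{M|_I}=i_p\circ\pi_p:\varprojlim M|_I\to\varinjlim M|_I$ is independent of $p\in I$, and $\operatorname{rank}(M|_I):=\operatorname{rank}(\psi_{M|_I})$. **Landscapes.** Let $d_m(x,y)=\max\{|x_1-y_1|,|x_2-y_2|\}$ on $ZZ\times\mathbb{Z}$ and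 $R_x^\epsilon=\{y\in ZZ\times\mathbb{Z}: d_m(x,y)\le\epsilon\}$. For $k\in\mathbb{N}$, $k\geq 1$, and $x\in ZZ\times \mathbb{Z}$, $\lambda_k(M)(x)=\sup\{\epsilon\ge 0:\operatorname{rank}(M|_{R_x^\epsilon})\ge k\}$, where $\epsilon$ ranges over the nonnegative integers and the supremum of the empty set is $0$. The landscape is $\lambda(M):(k,x)\mapsto\lambda_k(M)(x)$ and $d_\lambda^\infty(M,N)=\|\lambda(M)-\lambda(N)\|_\infty=\sup_{k,x}|\lambda_k(M)(x)-\lambda_k(N)(x)|$. **Block extension.** $\mathbb{Z}^{\mathrm{op}}\times\mathbb{Z}$ has the order $(a,b)\le(c,d)$ iff $c\le a$ and $b\le d$. Let $\iota:ZZ\hookrightarrow\mathbb{Z}^{\mathrm{op}}\times\mathbb{Z}$ be the order-preserving map with $\iota(i)=(i,i)$ for sink indices $i$ and $\iota(j)=(j+1,j-1)$ for source indices $j$. Let $U=\{(i,j)\in\mathbb{Z}^{\mathrm{op}}\times\mathbb{Z}: i\le j \text{ as integers}\}$ with inclusion $\kappa:U\hookrightarrow\mathbb{Z}^{\mathrm{op}}\times\mathbb{Z}$. For a poset map $F:A\to B$ and $M\in\mathbf{vec}^A$, the left Kan extension is $\mathrm{Lan}_F(M)(b)=\varinjlim M|_{\{a:F(a)\le b\}}$ and the right Kan extension is $\mathrm{Ran}_F(M)(b)=\varprojlim M|_{\{a:F(a)\ge b\}}$, with structure maps given by universal properties. The block extension functor is $E=\mathrm{Ran}_\kappa\circ(-)|_U\circ\mathrm{Lan}_\iota:\mathbf{vec}^{ZZ}\to\mathbf{vec}^{\mathbb{Z}^{\mathrm{op}}\times\mathbb{Z}}$.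 The functor $\mathcal{E}:\mathbf{vec}^{ZZ\times\mathbb{Z}}\to\mathbf{vec}^{\mathbb{Z}^{\mathrm{op}}\times\mathbb{Z}\times\mathbb{Z}}$ is given by $\mathcal{E}(M)(\cdot,\cdot,z)=E(M(\cdot,z))$, where for $z_1\le z_2$ the structure maps $\mathcal{E}(M)(\cdot,\cdot,z_1)\to\mathcal{E}(M)(\cdot,\cdot,z_2)$ are obtained by applying $E$ to the morphism $M(\cdot,z_1)\to M(\cdot,z_2)$ given by the structure maps of $M$; on a morphism $f$, $\mathcal{E}(f)$ is given at level $z$ by $E(f_z)$. **Interleavings.** For $v=(v_1,v_2,v_3)\in\mathbb{Z}^3$ with $v_1\le0$, $v_2,v_3\ge0$, and $F\in\mathbf{vec}^{\mathbb{Z}^{\mathrm{op}}\times\mathbb{Z}\times\mathbb{Z}}$, the shift $F_v$ is $F_v(x)=F(x+v)$, $F_v(x\le x')=F(x+v\le x'+v)$, and for a morphism $\eta$, $\eta_v(x)=\eta(x+v)$. Let $\psi_F^v:F\to F_v$ be the natural transformation with components $F(x\le x+v)$. $F,G$ are $v$-interleaved if there are natural transformations $\eta:F\to G_v$, $\nu:G\to F_v$ with $\nu_v\circ\eta=\psi_F^{2v}$ and $\eta_v\circ\nu=\psi_G^{2v}$. Define $d_I(F,G)$ as the infimum of all (integers) $\epsilon\ge0$ such that $F,G$ are $\epsilon(-1,1,1)$-interleaved, and $\infty$ if there is none. For extended zigzag modules, $d_I(M,N):=d_I(\mathcal{E}(M),\mathcal{E}(N))$. *)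

theory Defs
  imports
    "HOL-Library.Extended_Real"
    "HOL-Library.Product_Plus"
    "HOL-Algebra.AbelCoset"
    "Jordan_Normal_Form.Missing_VectorSpace"
begin

section \<open>Functors from a poset to vector spaces\<close>

text \<open>
  A poset is given by its order relation \<open>leq\<close> on a type; subposets are given by sets. A functor
  into vector spaces over \<open>K\<close> consists of an object part and a morphism part; \<open>mor M p q\<close> is only
  meaningful if \<open>p \<le> q\<close>, and only on the carrier of \<open>obj M p\<close>.
\<close>

record ('p, 'k, 'v) pmod =
  obj :: "'p \<Rightarrow> ('k, 'v) module"
  mor :: "'p \<Rightarrow> 'p \<Rightarrow> 'v \<Rightarrow> 'v"

definition vec_functor ::
  "('k, 'm) ring_scheme \<Rightarrow> ('p \<Rightarrow> 'p \<Rightarrow> bool) \<Rightarrow> ('p, 'k, 'v) pmod \<Rightarrow> bool" where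
  "vec_functor K leq M \<longleftrightarrow>
     (\<forall>p. vectorspace K (obj M p) \<and> vectorspace.fin_dim K (obj M p)) \<and>
     (\<forall>p q. leq p q \<longrightarrow> mor M p q \<in> module_hom K (obj M p) (obj M q)) \<and>
     (\<forall>p. \<forall>v\<in>carrier (obj M p). mor M p p v = v) \<and>
     (\<forall>p q r. leq p q \<longrightarrow> leq q r \<longrightarrow>
        (\<forall>v\<in>carrier (obj M p). mor M q r (mor M p q v) = mor M p r v))"

definition nat_trans ::
  "('k, 'm) ring_scheme \<Rightarrow> ('p \<Rightarrow> 'p \<Rightarrow> bool) \<Rightarrow> ('p, 'k, 'v) pmod \<Rightarrow> ('p, 'k, 'w) pmod
     \<Rightarrow> ('p \<Rightarrow> 'v \<Rightarrow> 'w) \<Rightarrow> bool" where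
  "nat_trans K leq M N f \<longleftrightarrow>
     (\<forall>p. f p \<in> module_hom K (obj M p) (obj N p)) \<and>
     (\<forall>p q. leq p q \<longrightarrow> (\<forall>v\<in>carrier (obj M p). f q (mor M p q v) = mor N p q (f p v)))"


section \<open>Direct summands and indecomposables\<close>

definition subfunctor ::
  "('k, 'm) ring_scheme \<Rightarrow> ('p \<Rightarrow> 'p \<Rightarrow> bool) \<Rightarrow> ('p, 'k, 'v) pmod \<Rightarrow> ('p \<Rightarrow> 'v set) \<Rightarrow> bool" where
  "subfunctor K leq M A \<longleftrightarrow>
     (\<forall>p. subspace K (A p) (obj M p)) \<and> (\<forall>p q. leq p q \<longrightarrow> mor M p q ` A p \<subseteq> A q)"

definition sub_pmod :: "('p, 'k, 'v) pmod \<Rightarrow> ('p \<Rightarrow> 'v set) \<Rightarrow> ('p, 'k, 'v) pmod" where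
  "sub_pmod M A = \<lparr>obj = \<lambda>p. (obj M p)\<lparr>carrier := A p\<rparr>, mor = mor M\<rparr>"

definition direct_sum_decomp ::
  "('k, 'm) ring_scheme \<Rightarrow> ('p \<Rightarrow> 'p \<Rightarrow> bool) \<Rightarrow> ('p, 'k, 'v) pmod
     \<Rightarrow> ('p \<Rightarrow> 'v set) \<Rightarrow> ('p \<Rightarrow> 'v set) \<Rightarrow> bool" where
  "direct_sum_decomp K leq M A B \<longleftrightarrow>
     subfunctor K leq M A \<and> subfunctor K leq M B \<and>
     (\<forall>p. A p <+>\<^bsub>obj M p\<^esub> B p = carrier (obj M p) \<and> A p \<inter> B p = {\<zero>\<^bsub>obj M p\<^esub>})"

definition support :: "('p, 'k, 'v) pmod \<Rightarrow> 'p set" where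
  "support M = {p. carrier (obj M p) \<noteq> {\<zero>\<^bsub>obj M p\<^esub>}}"

definition indecomposable ::
  "('k, 'm) ring_scheme \<Rightarrow> ('p \<Rightarrow> 'p \<Rightarrow> bool) \<Rightarrow> ('p, 'k, 'v) pmod \<Rightarrow> bool" where
  "indecomposable K leq M \<longleftrightarrow> support M \<noteq> {} \<and>
     (\<forall>A B. direct_sum_decomp K leq M A B \<longrightarrow>
        support (sub_pmod M A) = {} \<or> support (sub_pmod M B) = {})"

definition no_infinite_indec_summand ::
  "('k, 'm) ring_scheme \<Rightarrow> ('p \<Rightarrow> 'p \<Rightarrow> bool) \<Rightarrow> ('p, 'k, 'v) pmod \<Rightarrow> bool" where
  "no_infinite_indec_summand K leq M \<longleftrightarrow>
     (\<forall>A B. direct_sum_decomp K leq M A B \<longrightarrow> indecomposable K leq (sub_pmod M A) \<longrightarrow>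
        finite (support (sub_pmod M A)))"


section \<open>Limits and colimits\<close>

text \<open>
  The limit of \<open>M\<close> restricted to \<open>S\<close> is the space of compatible families. The colimit is the
  direct sum modulo the span of the elements \<open>v - M(p \<le> q)(v)\<close>, its elements being cosets. The
  fields \<open>mult\<close> and \<open>one\<close> of a module record play no role.
\<close>

definition limit :: "('p \<Rightarrow> 'p \<Rightarrow> bool) \<Rightarrow> ('p, 'k, 'v) pmod \<Rightarrow> 'p set \<Rightarrow> ('k, 'p \<Rightarrow> 'v) module" where
  "limit leq M S = \<lparr>
     carrier = {s \<in> \<Pi>\<^sub>E p\<in>S. carrier (obj M p). \<forall>p\<in>S. \<forall>q\<in>S. leq p q \<longrightarrow> mor M p q (s p) = s q},
     mult = undefined, one = undefined,
     zero = (\<lambda>p\<in>S. \<zero>\<^bsub>obj M p\<^esub>),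
     add = (\<lambda>s t. \<lambda>p\<in>S. s p \<oplus>\<^bsub>obj M p\<^esub> t p),
     smult = (\<lambda>c s. \<lambda>p\<in>S. c \<odot>\<^bsub>obj M p\<^esub> s p)\<rparr>"

definition dsum :: "('p, 'k, 'v) pmod \<Rightarrow> 'p set \<Rightarrow> ('k, 'p \<Rightarrow> 'v) module" where
  "dsum M S = \<lparr>
     carrier = {s \<in> \<Pi>\<^sub>E p\<in>S. carrier (obj M p). finite {p\<in>S. s p \<noteq> \<zero>\<^bsub>obj M p\<^esub>}},
     mult = undefined, one = undefined,
     zero = (\<lambda>p\<in>S. \<zero>\<^bsub>obj M p\<^esub>),
     add = (\<lambda>s t. \<lambda>p\<in>S. s p \<oplus>\<^bsub>obj M p\<^esub> t p),
     smult = (\<lambda>c s. \<lambda>p\<in>S. c \<odot>\<^bsub>obj M p\<^esub> s p)\<rparr>"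

definition dsum_inj :: "('p, 'k, 'v) pmod \<Rightarrow> 'p set \<Rightarrow> 'p \<Rightarrow> 'v \<Rightarrow> 'p \<Rightarrow> 'v" where
  "dsum_inj M S p v = (\<lambda>r\<in>S. if r = p then v else \<zero>\<^bsub>obj M r\<^esub>)"

definition colim_rel ::
  "('k, 'm) ring_scheme \<Rightarrow> ('p \<Rightarrow> 'p \<Rightarrow> bool) \<Rightarrow> ('p, 'k, 'v) pmod \<Rightarrow> 'p set \<Rightarrow> ('p \<Rightarrow> 'v) set" where
  "colim_rel K leq M S = module.span K (dsum M S)
     {dsum_inj M S p v \<ominus>\<^bsub>dsum M S\<^esub> dsum_inj M S q (mor M p q v) | p q v.
        p \<in> S \<and> q \<in> S \<and> leq p q \<and> v \<in> carrier (obj M p)}"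

definition quot_module :: "('k, 'v, 'd) module_scheme \<Rightarrow> 'v set \<Rightarrow> ('k, 'v set) module" where
  "quot_module V H = \<lparr>
     carrier = a_rcosets\<^bsub>V\<^esub> H,
     mult = undefined, one = undefined,
     zero = H,
     add = set_add V,
     smult = (\<lambda>c X. \<Union>x\<in>X. H +>\<^bsub>V\<^esub> (c \<odot>\<^bsub>V\<^esub> x))\<rparr>"

definition colimit ::
  "('k, 'm) ring_scheme \<Rightarrow> ('p \<Rightarrow> 'p \<Rightarrow> bool) \<Rightarrow> ('p, 'k, 'v) pmod \<Rightarrow> 'p set
     \<Rightarrow> ('k, ('p \<Rightarrow> 'v) set) module" where
  "colimit K leq M S = quot_module (dsum M S) (colim_rel K leq M S)"

definition colim_inj ::
  "('k, 'm) ring_scheme \<Rightarrow> ('p \<Rightarrow> 'p \<Rightarrow> bool) \<Rightarrow> ('p, 'k, 'v) pmod \<Rightarrow> 'p set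
     \<Rightarrow> 'p \<Rightarrow> 'v \<Rightarrow> ('p \<Rightarrow> 'v) set" where
  "colim_inj K leq M S p v = colim_rel K leq M S +>\<^bsub>dsum M S\<^esub> dsum_inj M S p v"

text \<open>
  The maps induced by a morphism with components \<open>f p : M p \<rightarrow> N p\<close>: on limits
  \<open>limit M S \<rightarrow> limit N T\<close> for \<open>T \<subseteq> S\<close>, on colimits \<open>colimit M S \<rightarrow> colimit N T\<close> for \<open>S \<subseteq> T\<close>.
\<close>

definition lim_map :: "'p set \<Rightarrow> ('p \<Rightarrow> 'v \<Rightarrow> 'w) \<Rightarrow> ('p \<Rightarrow> 'v) \<Rightarrow> 'p \<Rightarrow> 'w" where
  "lim_map T f s = (\<lambda>p\<in>T. f p (s p))"

definition colim_map ::
  "('k, 'm) ring_scheme \<Rightarrow> ('p \<Rightarrow> 'p \<Rightarrow> bool) \<Rightarrow> 'p set \<Rightarrow> ('p, 'k, 'w) pmod \<Rightarrow> 'p set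
     \<Rightarrow> ('p \<Rightarrow> 'v \<Rightarrow> 'w) \<Rightarrow> ('p \<Rightarrow> 'v) set \<Rightarrow> ('p \<Rightarrow> 'w) set" where
  "colim_map K leq S N T f X =
     (\<Union>x\<in>X. colim_rel K leq N T +>\<^bsub>dsum N T\<^esub> (\<lambda>p\<in>T. if p \<in> S then f p (x p) else \<zero>\<^bsub>obj N p\<^esub>))"


section \<open>Generalized rank\<close>

definition map_rank ::
  "('k, 'm) ring_scheme \<Rightarrow> ('k, 'v, 'd) module_scheme \<Rightarrow> ('k, 'w, 'e) module_scheme
     \<Rightarrow> ('v \<Rightarrow> 'w) \<Rightarrow> nat" where
  "map_rank K V W T = vectorspace.dim K (W\<lparr>carrier := T ` carrier V\<rparr>)"

text \<open>If \<open>I\<close> is connected, as every interval is, the map below does not depend on the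
  chosen \<open>p \<in> I\<close>.\<close>

definition lim_to_colim ::
  "('k, 'm) ring_scheme \<Rightarrow> ('p \<Rightarrow> 'p \<Rightarrow> bool) \<Rightarrow> ('p, 'k, 'v) pmod \<Rightarrow> 'p set
     \<Rightarrow> ('p \<Rightarrow> 'v) \<Rightarrow> ('p \<Rightarrow> 'v) set" where
  "lim_to_colim K leq M I s = (let p = (SOME p. p \<in> I) in colim_inj K leq M I p (s p))"

definition gen_rank ::
  "('k, 'm) ring_scheme \<Rightarrow> ('p \<Rightarrow> 'p \<Rightarrow> bool) \<Rightarrow> ('p, 'k, 'v) pmod \<Rightarrow> 'p set \<Rightarrow> nat" where
  "gen_rank K leq M I = map_rank K (limit leq M I) (colimit K leq M I) (lim_to_colim K leq M I)"


section \<open>Extended zigzag modules and their landscapes\<close>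

definition zz_le :: "int \<Rightarrow> int \<Rightarrow> bool" where
  "zz_le a b \<longleftrightarrow> a = b \<or> (odd a \<and> \<bar>a - b\<bar> = 1)"

abbreviation ezz_le :: "int \<times> int \<Rightarrow> int \<times> int \<Rightarrow> bool" where
  "ezz_le \<equiv> rel_prod zz_le (\<le>)"

definition extended_zigzag_module ::
  "('k, 'm) ring_scheme \<Rightarrow> (int \<times> int, 'k, 'v) pmod \<Rightarrow> bool" where
  "extended_zigzag_module K M \<longleftrightarrow> vec_functor K ezz_le M \<and> no_infinite_indec_summand K ezz_le M"

definition square :: "int \<times> int \<Rightarrow> nat \<Rightarrow> (int \<times> int) set" where
  "square x \<epsilon> = {y. max \<bar>fst x - fst y\<bar> \<bar>snd x - snd y\<bar> \<le> int \<epsilon>}"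

text \<open>
  The supremum is taken in \<^typ>\<open>nat\<close>, where \<open>Sup {} = 0\<close>. For an extended zigzag module and
  \<open>k \<ge> 1\<close> the set is bounded, because there are no infinite indecomposable summands.
\<close>

definition landscape ::
  "('k, 'm) ring_scheme \<Rightarrow> (int \<times> int, 'k, 'v) pmod \<Rightarrow> nat \<Rightarrow> int \<times> int \<Rightarrow> real" where
  "landscape K M k x = real (Sup {\<epsilon>. gen_rank K ezz_le M (square x \<epsilon>) \<ge> k})"

definition landscape_dist ::
  "('k, 'm) ring_scheme \<Rightarrow> (int \<times> int, 'k, 'v) pmod \<Rightarrow> (int \<times> int, 'k, 'w) pmod \<Rightarrow> ereal" where
  "landscape_dist K M N =
     (SUP (k, x) \<in> {1..} \<times> UNIV. ereal \<bar>landscape K M k x - landscape K N k x\<bar>)"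


section \<open>Kan extensions and the block extension functor\<close>

text \<open>
  Kan extensions along a poset map \<open>F\<close> from the subposet \<open>A\<close>. \<open>Lan_map\<close> and \<open>Ran_map\<close> are the
  components of the extension of a morphism \<open>f\<close>, for \<open>Lan_map\<close> with codomain \<open>N\<close>.
\<close>

definition Lan ::
  "('k, 'm) ring_scheme \<Rightarrow> 'a set \<Rightarrow> ('a \<Rightarrow> 'a \<Rightarrow> bool) \<Rightarrow> ('b \<Rightarrow> 'b \<Rightarrow> bool) \<Rightarrow> ('a \<Rightarrow> 'b)
     \<Rightarrow> ('a, 'k, 'v) pmod \<Rightarrow> ('b, 'k, ('a \<Rightarrow> 'v) set) pmod" where
  "Lan K A leA leB F M = \<lparr>
     obj = \<lambda>b. colimit K leA M {a\<in>A. leB (F a) b},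
     mor = \<lambda>b b'. colim_map K leA {a\<in>A. leB (F a) b} M {a\<in>A. leB (F a) b'} (\<lambda>_ v. v)\<rparr>"

definition Lan_map ::
  "('k, 'm) ring_scheme \<Rightarrow> 'a set \<Rightarrow> ('a \<Rightarrow> 'a \<Rightarrow> bool) \<Rightarrow> ('b \<Rightarrow> 'b \<Rightarrow> bool) \<Rightarrow> ('a \<Rightarrow> 'b)
     \<Rightarrow> ('a, 'k, 'w) pmod \<Rightarrow> ('a \<Rightarrow> 'v \<Rightarrow> 'w) \<Rightarrow> 'b \<Rightarrow> ('a \<Rightarrow> 'v) set \<Rightarrow> ('a \<Rightarrow> 'w) set" where
  "Lan_map K A leA leB F N f b =
     colim_map K leA {a\<in>A. leB (F a) b} N {a\<in>A. leB (F a) b} f"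

definition Ran ::
  "'a set \<Rightarrow> ('a \<Rightarrow> 'a \<Rightarrow> bool) \<Rightarrow> ('b \<Rightarrow> 'b \<Rightarrow> bool) \<Rightarrow> ('a \<Rightarrow> 'b)
     \<Rightarrow> ('a, 'k, 'v) pmod \<Rightarrow> ('b, 'k, 'a \<Rightarrow> 'v) pmod" where
  "Ran A leA leB F M = \<lparr>
     obj = \<lambda>b. limit leA M {a\<in>A. leB b (F a)},
     mor = \<lambda>b b'. lim_map {a\<in>A. leB b' (F a)} (\<lambda>_ v. v)\<rparr>"

definition Ran_map ::
  "'a set \<Rightarrow> ('b \<Rightarrow> 'b \<Rightarrow> bool) \<Rightarrow> ('a \<Rightarrow> 'b) \<Rightarrow> ('a \<Rightarrow> 'v \<Rightarrow> 'w)
     \<Rightarrow> 'b \<Rightarrow> ('a \<Rightarrow> 'v) \<Rightarrow> 'a \<Rightarrow> 'w" where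
  "Ran_map A leB F f b = lim_map {a\<in>A. leB b (F a)} f"

text \<open>\<open>opz_le\<close> is the order of \<open>\<int>\<^sup>o\<^sup>p \<times> \<int>\<close>, \<open>opzz_le\<close> that of \<open>\<int>\<^sup>o\<^sup>p \<times> \<int> \<times> \<int>\<close>.\<close>

abbreviation opz_le :: "int \<times> int \<Rightarrow> int \<times> int \<Rightarrow> bool" where
  "opz_le \<equiv> rel_prod (\<ge>) (\<le>)"

abbreviation opzz_le :: "int \<times> int \<times> int \<Rightarrow> int \<times> int \<times> int \<Rightarrow> bool" where
  "opzz_le \<equiv> rel_prod (\<ge>) (rel_prod (\<le>) (\<le>))"

definition iota :: "int \<Rightarrow> int \<times> int" where
  "iota i = (if even i then (i, i) else (i + 1, i - 1))"

definition U :: "(int \<times> int) set" where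
  "U = {(i, j). i \<le> j}"

type_synonym 'v block_elem = "int \<times> int \<Rightarrow> (int \<Rightarrow> 'v) set"

text \<open>
  The inclusion of \<open>U\<close> is \<open>id\<close> with domain \<open>U\<close>; restricting to \<open>U\<close> leaves the data of a functor
  unchanged, since \<open>Ran\<close> over \<open>U\<close> only inspects it there.
\<close>

definition block_ext ::
  "('k, 'm) ring_scheme \<Rightarrow> (int, 'k, 'v) pmod \<Rightarrow> (int \<times> int, 'k, 'v block_elem) pmod" where
  "block_ext K M = Ran U opz_le opz_le id (Lan K UNIV zz_le opz_le iota M)"

definition block_ext_map ::
  "('k, 'm) ring_scheme \<Rightarrow> (int, 'k, 'w) pmod \<Rightarrow> (int \<Rightarrow> 'v \<Rightarrow> 'w)
     \<Rightarrow> int \<times> int \<Rightarrow> 'v block_elem \<Rightarrow> 'w block_elem" where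
  "block_ext_map K N f = Ran_map U opz_le id (Lan_map K UNIV zz_le opz_le iota N f)"

definition slice :: "(int \<times> int, 'k, 'v) pmod \<Rightarrow> int \<Rightarrow> (int, 'k, 'v) pmod" where
  "slice M z = \<lparr>obj = \<lambda>a. obj M (a, z), mor = \<lambda>a b. mor M (a, z) (b, z)\<rparr>"

definition ext_block_ext ::
  "('k, 'm) ring_scheme \<Rightarrow> (int \<times> int, 'k, 'v) pmod
     \<Rightarrow> (int \<times> int \<times> int, 'k, 'v block_elem) pmod" where
  "ext_block_ext K M = \<lparr>
     obj = \<lambda>(a, b, z). obj (block_ext K (slice M z)) (a, b),
     mor = \<lambda>(a, b, z) (a', b', z').
       block_ext_map K (slice M z') (\<lambda>i. mor M (i, z) (i, z')) (a', b')
         \<circ> mor (block_ext K (slice M z)) (a, b) (a', b')\<rparr>"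


section \<open>Interleavings\<close>

definition shift :: "'p::plus \<Rightarrow> ('p, 'k, 'v) pmod \<Rightarrow> ('p, 'k, 'v) pmod" where
  "shift v F = \<lparr>obj = \<lambda>x. obj F (x + v), mor = \<lambda>x y. mor F (x + v) (y + v)\<rparr>"

definition interleaved ::
  "('k, 'm) ring_scheme \<Rightarrow> int \<times> int \<times> int \<Rightarrow> (int \<times> int \<times> int, 'k, 'v) pmod
     \<Rightarrow> (int \<times> int \<times> int, 'k, 'w) pmod \<Rightarrow> bool" where
  "interleaved K v F G \<longleftrightarrow> (\<exists>\<eta> \<nu>.
     nat_trans K opzz_le F (shift v G) \<eta> \<and> nat_trans K opzz_le G (shift v F) \<nu> \<and>
     (\<forall>x. \<forall>u\<in>carrier (obj F x). \<nu> (x + v) (\<eta> x u) = mor F x (x + (v + v)) u) \<and>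
     (\<forall>x. \<forall>u\<in>carrier (obj G x). \<eta> (x + v) (\<nu> x u) = mor G x (x + (v + v)) u))"

definition interleaving_dist ::
  "('k, 'm) ring_scheme \<Rightarrow> (int \<times> int \<times> int, 'k, 'v) pmod
     \<Rightarrow> (int \<times> int \<times> int, 'k, 'w) pmod \<Rightarrow> ereal" where
  "interleaving_dist K F G =
     (INF \<epsilon> \<in> {\<epsilon>::nat. interleaved K (- int \<epsilon>, int \<epsilon>, int \<epsilon>) F G}. ereal (real \<epsilon>))"

definition ezz_interleaving_dist ::
  "('k, 'm) ring_scheme \<Rightarrow> (int \<times> int, 'k, 'v) pmod \<Rightarrow> (int \<times> int, 'k, 'w) pmod \<Rightarrow> ereal" where
  "ezz_interleaving_dist K M N = interleaving_dist K (ext_block_ext K M) (ext_block_ext K N)"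

end

theory Submission
  imports Defs
begin

text \<open>
  The block extension of \<open>M\<close> at \<open>(i, j, z)\<close> is the colimit of the row \<open>M(\<cdot>, z)\<close> over the zigzag
  interval \<open>[i, j]\<close> if \<open>i \<le> j\<close>, and its limit over \<open>[j, i]\<close> if \<open>i \<ge> j\<close>. On a box
  \<open>[a, b] \<times> [z, z']\<close> the limit of \<open>M\<close> only depends on the bottom row and the colimit only on the top
  row, so the generalised rank of \<open>M\<close> on the box is the rank of the structure map of the block
  extension from \<open>(b, a, z)\<close> to \<open>(a, b, z')\<close>. For the square of radius \<open>r\<close> around \<open>x\<close>, an
  \<open>\<epsilon>\<close>-interleaving with \<open>\<epsilon> \<le> r\<close> factors this map through the corresponding map of \<open>N\<close> for the
  square of radius \<open>r - \<epsilon>\<close>. Hence the rank of \<open>M\<close> on the larger square is at most that of \<open>N\<close> on the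
  smaller one, which moves the suprema defining the landscapes by at most \<open>\<epsilon>\<close>.

  Instead of isomorphisms, linear maps from the limit over the box to the block extension and from
  the block extension to the colimit over the box, and maps in the opposite directions, are used:
  they suffice for the factorisation.
\<close>

section \<open>Ranks of linear maps\<close>

text \<open>A subset of \<open>W\<close> that is independent in \<open>W\<close> is independent in
  \<open>V\<close>, so its size is at most \<open>dim\<close>. Hence a maximal independent subset
  exists, and it is a basis of \<open>W\<close>.\<close>

lemma (in vectorspace) subspace_fin_dim_le:
  assumes fd: "fin_dim" and W: "subspace K W V"
  shows "vectorspace.fin_dim K (vs W)" and "vectorspace.dim K (vs W) \<le> dim"
proof -
  interpret W: vectorspace K "vs W"
    using subspace_is_vs[OF W] .
  have sub: "submodule K W V"
    using W by simp
  have WV: "W \<subseteq> carrier V"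
    using submodule.subset[OF sub] .
  have li: "finite S \<and> card S \<le> dim" if "S \<subseteq> W \<and> W.lin_indpt S" for S
  proof -
    have "S \<subseteq> carrier V" and "lin_indpt S"
      using that WV span_li_not_depend(2)[OF _ sub, of S] by blast+
    then show ?thesis
      using li_le_dim[OF fd] by blast
  qed
  then obtain B where fB: "finite B" and B: "maximal B (\<lambda>S. S \<subseteq> W \<and> W.lin_indpt S)"
    using maximal_exists[of "\<lambda>S. S \<subseteq> W \<and> W.lin_indpt S" dim "{}", OF li]
    unfolding W.lin_dep_def by blast
  have basis: "W.basis B"
    using W.max_li_is_basis[of B] B by simp
  then show "W.fin_dim"
    using fB unfolding W.fin_dim_def W.basis_def by auto
  have "card B \<le> dim"
    using li[of B] B unfolding maximal_def by blast
  then show "W.dim \<le> dim"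
    using W.dim_basis[OF fB basis] by simp
qed

lemma module_homI:
  assumes "\<And>x. x \<in> carrier V \<Longrightarrow> f x \<in> carrier W"
    and "\<And>x y. x \<in> carrier V \<Longrightarrow> y \<in> carrier V \<Longrightarrow> f (x \<oplus>\<^bsub>V\<^esub> y) = f x \<oplus>\<^bsub>W\<^esub> f y"
    and "\<And>c x. c \<in> carrier K \<Longrightarrow> x \<in> carrier V \<Longrightarrow> f (c \<odot>\<^bsub>V\<^esub> x) = c \<odot>\<^bsub>W\<^esub> f x"
  shows "f \<in> module_hom K V W"
  using assms by (simp add: module_hom_def)

lemma module_hom_comp:
  "g \<in> module_hom K V W \<Longrightarrow> f \<in> module_hom K V' V \<Longrightarrow> (\<lambda>x. g (f x)) \<in> module_hom K V' W"
  by (auto simp: module_hom_def Pi_iff)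

lemma module_hom_cong:
  assumes "module K V" "f \<in> module_hom K V W" "\<And>x. x \<in> carrier V \<Longrightarrow> g x = f x"
  shows "g \<in> module_hom K V W"
proof -
  interpret module K V by fact
  show ?thesis
    using assms(2,3) by (auto simp: module_hom_def Pi_iff)
qed

lemma submoduleI:
  assumes "module K V" "A \<subseteq> carrier V" "\<zero>\<^bsub>V\<^esub> \<in> A"
    and "\<And>x y. x \<in> A \<Longrightarrow> y \<in> A \<Longrightarrow> x \<oplus>\<^bsub>V\<^esub> y \<in> A"
    and "\<And>c x. c \<in> carrier K \<Longrightarrow> x \<in> A \<Longrightarrow> c \<odot>\<^bsub>V\<^esub> x \<in> A"
  shows "submodule K A V"
  using assms by (simp add: submodule_def)

lemma linear_mapI:
  "vectorspace K V \<Longrightarrow> vectorspace K W \<Longrightarrow> f \<in> module_hom K V W \<Longrightarrow> linear_map K V W f"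
  by (simp add: linear_map_def mod_hom_def mod_hom_axioms_def vectorspace_def)

lemma (in linear_map) fin_dim_image:
  assumes "V.fin_dim"
  shows "vectorspace.fin_dim K (W\<lparr>carrier := T ` carrier V\<rparr>)"
    and "vectorspace.dim K (W\<lparr>carrier := T ` carrier V\<rparr>) \<le> V.dim"
proof -
  have vs: "vectorspace K (W\<lparr>carrier := T ` carrier V\<rparr>)"
    using W.subspace_is_vs[OF imT_is_subspace] by (simp add: im_def)
  interpret T': linear_map K V "W\<lparr>carrier := T ` carrier V\<rparr>" T
    using f_hom by (intro linear_mapI vs V.vectorspace_axioms) (auto simp: module_hom_def)
  show "vectorspace.fin_dim K (W\<lparr>carrier := T ` carrier V\<rparr>)"
    using T'.rank_nullity_main(2)[OF assms] by simp
  show "vectorspace.dim K (W\<lparr>carrier := T ` carrier V\<rparr>) \<le> V.dim"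
    using rank_nullity[OF assms] by (simp add: im_def)
qed

text \<open>The image of the composite lies in \<open>g\<close> applied to the image of
  \<open>T\<close>, and \<open>g\<close> cannot raise the dimension of that image. Finite dimension
  is asked of the image of \<open>T\<close> only, so it never has to be proved for whole limits and
  colimits.\<close>

lemma map_rank_factor_le:
  assumes V: "vectorspace K V" and W: "vectorspace K W"
    and V': "vectorspace K V'" and W': "vectorspace K W'"
    and T: "T \<in> module_hom K V W" and f: "f \<in> module_hom K V' V" and g: "g \<in> module_hom K W W'"
    and fd: "vectorspace.fin_dim K (W\<lparr>carrier := T ` carrier V\<rparr>)"
    and T': "\<And>x. x \<in> carrier V' \<Longrightarrow> T' x = g (T (f x))"
  shows "map_rank K V' W' T' \<le> map_rank K V W T"
proof -
  define A where "A = T ` carrier V"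
  interpret T: linear_map K V W T
    using V W T by (rule linear_mapI)
  interpret W': vectorspace K W' by fact
  have A: "subspace K A W"
    using T.imT_is_subspace by (simp add: T.im_def A_def)
  have AW: "A \<subseteq> carrier W"
    unfolding A_def by auto
  interpret g: linear_map K "W\<lparr>carrier := A\<rparr>" W' g
    using g AW
    by (intro linear_mapI T.W.subspace_is_vs A W') (auto simp: module_hom_def Pi_iff subset_iff)
  have gA: "subspace K (g ` A) W'"
    using g.imT_is_subspace by (simp add: g.im_def)
  have fdA: "g.V.fin_dim"
    using fd by (simp add: A_def)
  interpret h: linear_map K V' W' "\<lambda>x. g (T (f x))"
    by (intro linear_mapI V' W' module_hom_comp[OF g] module_hom_comp[OF T] f)
  have im: "T' ` carrier V' = h.imT"
    unfolding h.im_def by (rule image_cong) (auto simp: T')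
  interpret gA: vectorspace K "W'\<lparr>carrier := g ` A\<rparr>"
    by (rule W'.subspace_is_vs[OF gA])
  have "h.imT \<subseteq> g ` A"
    using f unfolding h.im_def A_def module_hom_def by auto
  moreover have "subspace K h.imT W'"
    by (rule h.imT_is_subspace)
  moreover have "submodule K (g ` A) W'"
    using gA by simp
  \<comment> \<open>Dimensions are compared inside the image of \<open>A\<close> under
    \<open>g\<close>, which is finite-dimensional, whereas \<open>W'\<close> may not be.\<close>
  ultimately have sub: "subspace K h.imT (W'\<lparr>carrier := g ` A\<rparr>)"
    by (auto simp: subspace_def submodule_def gA.vectorspace_axioms gA.module_axioms)
  have fdg: "gA.fin_dim" and dg: "gA.dim \<le> g.V.dim"
    using g.fin_dim_image[OF fdA] by simp_all
  show ?thesis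
    using gA.subspace_fin_dim_le(2)[OF fdg sub] dg
    by (simp add: map_rank_def im A_def)
qed

section \<open>Quotient spaces\<close>

locale quotient_space = vectorspace K V + H: submodule K H V for K and V (structure) and H
begin

lemma uminus_in_subspace: "h \<in> H \<Longrightarrow> \<ominus> h \<in> H"
  using H.smult_closed[of "\<ominus>\<^bsub>K\<^esub> \<one>\<^bsub>K\<^esub>" h] subsetD[OF H.subset] smult_minus_1[of h] by simp

text \<open>This makes the coset calculus of abelian groups available. Closure under negation comes
  from multiplication by the scalar -1.\<close>

sublocale abelian_subgroup H V
proof (rule abelian_subgroupI3)
  have "subgroup H (add_monoid V)"
    using H.subset by (intro add.subgroupI uminus_in_subspace H.m_closed) (auto intro: H.zero_closed)
  then show "additive_subgroup H V"
    by (rule additive_subgroup.intro)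
qed (rule abelian_group_axioms)

lemma carrier_quot_module: "carrier (quot_module V H) = (\<lambda>x. H +> x) ` carrier V"
  by (auto simp: quot_module_def A_RCOSETS_def')

lemma quot_module_add:
  "x \<in> carrier V \<Longrightarrow> y \<in> carrier V \<Longrightarrow>
    (H +> x) \<oplus>\<^bsub>quot_module V H\<^esub> (H +> y) = H +> (x \<oplus> y)"
  by (simp add: quot_module_def a_rcos_sum)

lemma quot_module_zero: "\<zero>\<^bsub>quot_module V H\<^esub> = H +> \<zero>"
  using a_coset_add_zero[OF H.subset] by (simp add: quot_module_def)

lemma coset_eqI:
  assumes "x \<in> carrier V" "y \<in> carrier V" "x \<ominus> y \<in> H"
  shows "H +> x = H +> y"
  using a_rcos_module[of y x] a_repr_independence'[of x y] assms by (simp add: a_minus_def)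

lemma coset_memD: "x \<in> H +> y \<Longrightarrow> y \<in> carrier V \<Longrightarrow> x \<in> carrier V \<and> x \<ominus> y \<in> H"
  using a_rcos_module[of y x] a_elemrcos_carrier[of y x] by (simp add: a_minus_def)

text \<open>The scalar multiple of a coset is defined as a union over its representatives. Two
  representatives differ by an element of \<open>H\<close>, and so do their multiples by
  \<open>c\<close>; all members of the union are therefore the same coset.\<close>

lemma quot_module_smult:
  assumes c: "c \<in> carrier K" and v: "v \<in> carrier V"
  shows "c \<odot>\<^bsub>quot_module V H\<^esub> (H +> v) = H +> (c \<odot> v)"
proof -
  have "H +> (c \<odot> x) = H +> (c \<odot> v)" if "x \<in> H +> v" for x
  proof (rule coset_eqI)
    have x: "x \<in> carrier V" "x \<ominus> v \<in> H"
      using coset_memD[OF that v] by auto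
    then have "c \<odot> x \<ominus> c \<odot> v = c \<odot> (x \<ominus> v)"
      using c v by (simp add: a_minus_def smult_r_distr smult_r_minus)
    then show "c \<odot> x \<ominus> c \<odot> v \<in> H"
      using x c by simp
    show "c \<odot> x \<in> carrier V" "c \<odot> v \<in> carrier V"
      using x c v by auto
  qed
  moreover have "H +> v \<noteq> {}"
    using a_rcos_self[OF v] by blast
  ultimately have "(\<Union>x\<in>H +> v. H +> (c \<odot> x)) = H +> (c \<odot> v)"
    by (intro SUP_eq_const)
  then show ?thesis
    unfolding quot_module_def by simp
qed

lemma vectorspace_quot_module: "vectorspace K (quot_module V H)"
proof (rule vs_criteria)
  note quot = carrier_quot_module quot_module_add quot_module_smult quot_module_zero
  show "\<forall>X\<in>carrier (quot_module V H). \<exists>Y\<in>carrier (quot_module V H).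
      X \<oplus>\<^bsub>quot_module V H\<^esub> Y = \<zero>\<^bsub>quot_module V H\<^esub>"
  proof
    fix X assume "X \<in> carrier (quot_module V H)"
    then obtain x where x: "x \<in> carrier V" "X = H +> x"
      by (auto simp: quot)
    then have "X \<oplus>\<^bsub>quot_module V H\<^esub> (H +> \<ominus> x) = \<zero>\<^bsub>quot_module V H\<^esub>"
      by (simp add: quot r_neg)
    then show "\<exists>Y\<in>carrier (quot_module V H). X \<oplus>\<^bsub>quot_module V H\<^esub> Y = \<zero>\<^bsub>quot_module V H\<^esub>"
      using x by (auto simp: quot)
  qed
  show "\<zero>\<^bsub>quot_module V H\<^esub> \<in> carrier (quot_module V H)"
    unfolding quot by (rule imageI) simp
  show "\<forall>X Y. X \<in> carrier (quot_module V H) \<and> Y \<in> carrier (quot_module V H) \<longrightarrow>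
      X \<oplus>\<^bsub>quot_module V H\<^esub> Y = Y \<oplus>\<^bsub>quot_module V H\<^esub> X"
    by (clarsimp simp: quot_module_add carrier_quot_module) (simp add: a_comm)
  show "\<forall>X Y Z. X \<in> carrier (quot_module V H) \<and> Y \<in> carrier (quot_module V H) \<and>
      Z \<in> carrier (quot_module V H) \<longrightarrow>
      X \<oplus>\<^bsub>quot_module V H\<^esub> Y \<oplus>\<^bsub>quot_module V H\<^esub> Z = X \<oplus>\<^bsub>quot_module V H\<^esub> (Y \<oplus>\<^bsub>quot_module V H\<^esub> Z)"
    by (clarsimp simp: quot_module_add carrier_quot_module) (simp add: a_assoc)
  show "\<forall>X\<in>carrier (quot_module V H). X \<oplus>\<^bsub>quot_module V H\<^esub> \<zero>\<^bsub>quot_module V H\<^esub> = X"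
    unfolding quot_module_zero by (auto simp: carrier_quot_module quot_module_add simp del: a_coset_add_zero)
  show "\<forall>X Y. X \<in> carrier (quot_module V H) \<and> Y \<in> carrier (quot_module V H) \<longrightarrow>
      X \<oplus>\<^bsub>quot_module V H\<^esub> Y \<in> carrier (quot_module V H)"
    by (clarsimp simp: quot_module_add carrier_quot_module)
  show "\<forall>c X. c \<in> carrier K \<and> X \<in> carrier (quot_module V H) \<longrightarrow>
      c \<odot>\<^bsub>quot_module V H\<^esub> X \<in> carrier (quot_module V H)"
    by (clarsimp simp: quot_module_smult carrier_quot_module)
  show "\<forall>X\<in>carrier (quot_module V H). \<one>\<^bsub>K\<^esub> \<odot>\<^bsub>quot_module V H\<^esub> X = X"
    by (clarsimp simp: quot_module_smult carrier_quot_module)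
  show "\<forall>a b X. a \<in> carrier K \<and> b \<in> carrier K \<and> X \<in> carrier (quot_module V H) \<longrightarrow>
      (a \<otimes>\<^bsub>K\<^esub> b) \<odot>\<^bsub>quot_module V H\<^esub> X =
      a \<odot>\<^bsub>quot_module V H\<^esub> (b \<odot>\<^bsub>quot_module V H\<^esub> X)"
    by (clarsimp simp: quot_module_smult carrier_quot_module) (simp add: smult_assoc1)
  show "\<forall>a b X. a \<in> carrier K \<and> b \<in> carrier K \<and> X \<in> carrier (quot_module V H) \<longrightarrow>
      (a \<oplus>\<^bsub>K\<^esub> b) \<odot>\<^bsub>quot_module V H\<^esub> X =
      a \<odot>\<^bsub>quot_module V H\<^esub> X \<oplus>\<^bsub>quot_module V H\<^esub> b \<odot>\<^bsub>quot_module V H\<^esub> X"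
    by (clarsimp simp: quot_module_smult quot_module_add carrier_quot_module) (simp add: smult_l_distr)
  show "\<forall>a X Y. a \<in> carrier K \<and> X \<in> carrier (quot_module V H) \<and> Y \<in> carrier (quot_module V H) \<longrightarrow>
      a \<odot>\<^bsub>quot_module V H\<^esub> (X \<oplus>\<^bsub>quot_module V H\<^esub> Y) =
      a \<odot>\<^bsub>quot_module V H\<^esub> X \<oplus>\<^bsub>quot_module V H\<^esub> a \<odot>\<^bsub>quot_module V H\<^esub> Y"
  proof -
    have "a \<odot>\<^bsub>quot_module V H\<^esub> ((H +> x) \<oplus>\<^bsub>quot_module V H\<^esub> (H +> y)) =
        a \<odot>\<^bsub>quot_module V H\<^esub> (H +> x) \<oplus>\<^bsub>quot_module V H\<^esub> a \<odot>\<^bsub>quot_module V H\<^esub> (H +> y)"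
      if "a \<in> carrier K" "x \<in> carrier V" "y \<in> carrier V" for a x y
    proof -
      have closed: "x \<oplus> y \<in> carrier V" "a \<odot> x \<in> carrier V" "a \<odot> y \<in> carrier V"
        using that by auto
      show ?thesis
        unfolding quot_module_add[OF that(2,3)] quot_module_smult[OF that(1) closed(1)]
          quot_module_smult[OF that(1,2)] quot_module_smult[OF that(1,3)]
          quot_module_add[OF closed(2,3)] smult_r_distr[OF that] ..
    qed
    then show ?thesis
      unfolding carrier_quot_module by blast
  qed
qed (rule field_axioms)

lemma coset_hom: "(\<lambda>x. H +> x) \<in> module_hom K V (quot_module V H)"
proof (rule module_homI)
  show "H +> x \<in> carrier (quot_module V H)" if "x \<in> carrier V" for x
    using that unfolding carrier_quot_module by (rule imageI)
  show "H +> (x \<oplus> y) = (H +> x) \<oplus>\<^bsub>quot_module V H\<^esub> (H +> y)"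
    if "x \<in> carrier V" "y \<in> carrier V" for x y
    using that by (rule quot_module_add[symmetric])
  show "H +> (c \<odot> x) = c \<odot>\<^bsub>quot_module V H\<^esub> (H +> x)"
    if "c \<in> carrier K" "x \<in> carrier V" for c x
    using that by (rule quot_module_smult[symmetric])
qed

lemma hom_coset_eq:
  assumes W: "vectorspace K W" and f: "f \<in> module_hom K V W"
    and f0: "\<And>h. h \<in> H \<Longrightarrow> f h = \<zero>\<^bsub>W\<^esub>"
    and x: "x \<in> carrier V" and y: "y \<in> H +> x"
  shows "f y = f x"
proof -
  interpret W: vectorspace K W by fact
  have y: "y \<in> carrier V" "y \<ominus> x \<in> H"
    using coset_memD[OF y x] by auto
  have "y = (y \<ominus> x) \<oplus> x"
    using x y by (simp add: a_minus_def a_assoc l_neg)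
  then have "f y = f (y \<ominus> x) \<oplus>\<^bsub>W\<^esub> f x"
    using module_hom_add[OF f, of "y \<ominus> x" x] x y by simp
  then show ?thesis
    using f0[OF y(2)] module_hom_closed[OF f] x by (simp add: Pi_iff)
qed

end

text \<open>Evaluation at an arbitrary representative is well defined when \<open>f\<close> is
  linear and vanishes on \<open>H\<close>; this is what \<open>hom_coset_eq\<close>
  provides.\<close>

definition quot_lift :: "('v \<Rightarrow> 'w) \<Rightarrow> 'v set \<Rightarrow> 'w" where
  "quot_lift f X = f (SOME x. x \<in> X)"

context quotient_space
begin

lemma quot_lift_coset:
  assumes "vectorspace K W" "f \<in> module_hom K V W" "\<And>h. h \<in> H \<Longrightarrow> f h = \<zero>\<^bsub>W\<^esub>" "x \<in> carrier V"
  shows "quot_lift f (H +> x) = f x"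
proof -
  have "(SOME y. y \<in> H +> x) \<in> H +> x"
    by (rule someI[of "\<lambda>y. y \<in> H +> x", OF a_rcos_self[OF assms(4)]])
  then show ?thesis
    unfolding quot_lift_def by (intro hom_coset_eq[OF assms(1,2) _ assms(4)] assms(3))
qed

lemma quot_lift_hom:
  assumes "vectorspace K W" "f \<in> module_hom K V W" "\<And>h. h \<in> H \<Longrightarrow> f h = \<zero>\<^bsub>W\<^esub>"
  shows "quot_lift f \<in> module_hom K (quot_module V H) W"
proof (rule module_homI)
  have lift: "quot_lift f (H +> x) = f x" if "x \<in> carrier V" for x
    by (intro quot_lift_coset[OF assms(1,2) _ that] assms(3))
  fix X assume "X \<in> carrier (quot_module V H)"
  then obtain x where x: "x \<in> carrier V" and X: "X = H +> x"
    unfolding carrier_quot_module by blast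
  show "quot_lift f X \<in> carrier W"
    unfolding X lift[OF x] using module_hom_closed[OF assms(2)] x by (rule funcset_mem)
  show "quot_lift f (c \<odot>\<^bsub>quot_module V H\<^esub> X) = c \<odot>\<^bsub>W\<^esub> quot_lift f X" if "c \<in> carrier K" for c
    unfolding X lift[OF x] quot_module_smult[OF that x] lift[OF smult_closed[OF that x]]
    by (rule module_hom_smult[OF assms(2) that x])
  fix Y assume "Y \<in> carrier (quot_module V H)"
  then obtain y where y: "y \<in> carrier V" and Y: "Y = H +> y"
    unfolding carrier_quot_module by blast
  show "quot_lift f (X \<oplus>\<^bsub>quot_module V H\<^esub> Y) = quot_lift f X \<oplus>\<^bsub>W\<^esub> quot_lift f Y"
    unfolding X Y lift[OF x] lift[OF y] quot_module_add[OF x y] lift[OF add.m_closed[OF x y]]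
    by (rule module_hom_add[OF assms(2) x y])
qed

end

section \<open>Limits and colimits\<close>

text \<open>Common ambient space of \<open>limit\<close> and \<open>dsum\<close>. Both have its
  operations and differ from it only in the carrier, so the vector space laws are checked once, and
  for the other two only closure remains.\<close>

definition product :: "('p, 'k, 'v) pmod \<Rightarrow> 'p set \<Rightarrow> ('k, 'p \<Rightarrow> 'v) module" where
  "product M S = \<lparr>
     carrier = \<Pi>\<^sub>E p\<in>S. carrier (obj M p),
     mult = undefined, one = undefined,
     zero = (\<lambda>p\<in>S. \<zero>\<^bsub>obj M p\<^esub>),
     add = (\<lambda>s t. \<lambda>p\<in>S. s p \<oplus>\<^bsub>obj M p\<^esub> t p),
     smult = (\<lambda>c s. \<lambda>p\<in>S. c \<odot>\<^bsub>obj M p\<^esub> s p)\<rparr>"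

lemma product_simps:
  "carrier (product M S) = (\<Pi>\<^sub>E p\<in>S. carrier (obj M p))"
  "\<zero>\<^bsub>product M S\<^esub> = (\<lambda>p\<in>S. \<zero>\<^bsub>obj M p\<^esub>)"
  "s \<oplus>\<^bsub>product M S\<^esub> t = (\<lambda>p\<in>S. s p \<oplus>\<^bsub>obj M p\<^esub> t p)"
  "c \<odot>\<^bsub>product M S\<^esub> s = (\<lambda>p\<in>S. c \<odot>\<^bsub>obj M p\<^esub> s p)"
  by (simp_all add: product_def)

lemma limit_simps:
  "carrier (limit leq M S) =
    {s \<in> \<Pi>\<^sub>E p\<in>S. carrier (obj M p). \<forall>p\<in>S. \<forall>q\<in>S. leq p q \<longrightarrow> mor M p q (s p) = s q}"
  "\<zero>\<^bsub>limit leq M S\<^esub> = (\<lambda>p\<in>S. \<zero>\<^bsub>obj M p\<^esub>)"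
  "s \<oplus>\<^bsub>limit leq M S\<^esub> t = (\<lambda>p\<in>S. s p \<oplus>\<^bsub>obj M p\<^esub> t p)"
  "c \<odot>\<^bsub>limit leq M S\<^esub> s = (\<lambda>p\<in>S. c \<odot>\<^bsub>obj M p\<^esub> s p)"
  by (simp_all add: limit_def)

lemma dsum_simps:
  "carrier (dsum M S) =
    {s \<in> \<Pi>\<^sub>E p\<in>S. carrier (obj M p). finite {p\<in>S. s p \<noteq> \<zero>\<^bsub>obj M p\<^esub>}}"
  "\<zero>\<^bsub>dsum M S\<^esub> = (\<lambda>p\<in>S. \<zero>\<^bsub>obj M p\<^esub>)"
  "s \<oplus>\<^bsub>dsum M S\<^esub> t = (\<lambda>p\<in>S. s p \<oplus>\<^bsub>obj M p\<^esub> t p)"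
  "c \<odot>\<^bsub>dsum M S\<^esub> s = (\<lambda>p\<in>S. c \<odot>\<^bsub>obj M p\<^esub> s p)"
  by (simp_all add: dsum_def)

lemma vectorspace_product:
  assumes "field K" and M: "\<And>p. p \<in> S \<Longrightarrow> vectorspace K (obj M p)"
  shows "vectorspace K (product M S)"
proof (rule vs_criteria)
  have mod: "module K (obj M p)" and ab: "abelian_group (obj M p)" if "p \<in> S" for p
  proof -
    interpret vectorspace K "obj M p"
      using that by (rule M)
    show "module K (obj M p)" "abelian_group (obj M p)"
      by (rule module_axioms abelian_group_axioms)+
  qed
  note ab_monoid = abelian_group.axioms(1)[OF ab]
  show "\<zero>\<^bsub>product M S\<^esub> \<in> carrier (product M S)"
    by (auto simp: product_simps abelian_monoid.zero_closed[OF ab_monoid])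
  show "\<forall>v w. v \<in> carrier (product M S) \<and> w \<in> carrier (product M S) \<longrightarrow>
      v \<oplus>\<^bsub>product M S\<^esub> w \<in> carrier (product M S)"
    by (auto simp: product_simps PiE_iff abelian_monoid.a_closed[OF ab_monoid])
  show "\<forall>c v. c \<in> carrier K \<and> v \<in> carrier (product M S) \<longrightarrow>
      c \<odot>\<^bsub>product M S\<^esub> v \<in> carrier (product M S)"
    by (auto simp: product_simps PiE_iff module.smult_closed[OF mod])
  show "\<forall>v\<in>carrier (product M S). \<exists>w\<in>carrier (product M S). v \<oplus>\<^bsub>product M S\<^esub> w = \<zero>\<^bsub>product M S\<^esub>"
  proof
    fix v assume v: "v \<in> carrier (product M S)"
    show "\<exists>w\<in>carrier (product M S). v \<oplus>\<^bsub>product M S\<^esub> w = \<zero>\<^bsub>product M S\<^esub>"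
      using v by (intro bexI[of _ "\<lambda>p\<in>S. \<ominus>\<^bsub>obj M p\<^esub> v p"])
        (auto simp: product_simps PiE_iff abelian_group.r_neg[OF ab] abelian_group.a_inv_closed[OF ab])
  qed
  show "\<forall>v w. v \<in> carrier (product M S) \<and> w \<in> carrier (product M S) \<longrightarrow>
      v \<oplus>\<^bsub>product M S\<^esub> w = w \<oplus>\<^bsub>product M S\<^esub> v"
    by (auto simp: product_simps PiE_iff intro!: restrict_ext abelian_monoid.a_comm[OF ab_monoid])
  show "\<forall>v w x. v \<in> carrier (product M S) \<and> w \<in> carrier (product M S) \<and> x \<in> carrier (product M S) \<longrightarrow>
      v \<oplus>\<^bsub>product M S\<^esub> w \<oplus>\<^bsub>product M S\<^esub> x = v \<oplus>\<^bsub>product M S\<^esub> (w \<oplus>\<^bsub>product M S\<^esub> x)"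
    by (auto simp: product_simps PiE_iff abelian_monoid.a_assoc[OF ab_monoid] intro!: restrict_ext)
  show "\<forall>v\<in>carrier (product M S). v \<oplus>\<^bsub>product M S\<^esub> \<zero>\<^bsub>product M S\<^esub> = v"
    by (auto simp: product_simps PiE_iff abelian_monoid.r_zero[OF ab_monoid] extensional_def)
  show "\<forall>v\<in>carrier (product M S). \<one>\<^bsub>K\<^esub> \<odot>\<^bsub>product M S\<^esub> v = v"
    by (auto simp: product_simps PiE_iff module.smult_one[OF mod] extensional_def)
  show "\<forall>a b v. a \<in> carrier K \<and> b \<in> carrier K \<and> v \<in> carrier (product M S) \<longrightarrow>
      (a \<otimes>\<^bsub>K\<^esub> b) \<odot>\<^bsub>product M S\<^esub> v =
      a \<odot>\<^bsub>product M S\<^esub> (b \<odot>\<^bsub>product M S\<^esub> v)"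
    by (auto simp: product_simps PiE_iff module.smult_assoc1[OF mod] intro!: restrict_ext)
  show "\<forall>a b v. a \<in> carrier K \<and> b \<in> carrier K \<and> v \<in> carrier (product M S) \<longrightarrow>
      (a \<oplus>\<^bsub>K\<^esub> b) \<odot>\<^bsub>product M S\<^esub> v =
      a \<odot>\<^bsub>product M S\<^esub> v \<oplus>\<^bsub>product M S\<^esub> b \<odot>\<^bsub>product M S\<^esub> v"
    by (auto simp: product_simps PiE_iff module.smult_l_distr[OF mod] intro!: restrict_ext)
  show "\<forall>a v w. a \<in> carrier K \<and> v \<in> carrier (product M S) \<and> w \<in> carrier (product M S) \<longrightarrow>
      a \<odot>\<^bsub>product M S\<^esub> (v \<oplus>\<^bsub>product M S\<^esub> w) =
      a \<odot>\<^bsub>product M S\<^esub> v \<oplus>\<^bsub>product M S\<^esub> a \<odot>\<^bsub>product M S\<^esub> w"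
    by (auto simp: product_simps PiE_iff module.smult_r_distr[OF mod] intro!: restrict_ext)
qed (rule \<open>field K\<close>)

section \<open>Limits and colimits of a functor are vector spaces\<close>

locale vec_diagram =
  fixes K :: "('k, 'm) ring_scheme" and leq :: "'p \<Rightarrow> 'p \<Rightarrow> bool" and M :: "('p, 'k, 'v) pmod"
  assumes is_functor: "vec_functor K leq M"
begin

sublocale obj: vectorspace K "obj M p" for p
  using is_functor by (simp add: vec_functor_def)

lemma fin_dim: "obj.fin_dim p"
  using is_functor by (simp add: vec_functor_def)

lemma mor_hom: "leq p q \<Longrightarrow> mor M p q \<in> module_hom K (obj M p) (obj M q)"
  using is_functor by (simp add: vec_functor_def)

lemma mor_closed: "leq p q \<Longrightarrow> v \<in> carrier (obj M p) \<Longrightarrow> mor M p q v \<in> carrier (obj M q)"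
  using module_hom_closed[OF mor_hom] by (simp add: Pi_iff)

lemma mor_refl: "v \<in> carrier (obj M p) \<Longrightarrow> mor M p p v = v"
  using is_functor by (simp add: vec_functor_def)

lemma mor_mor:
  "leq p q \<Longrightarrow> leq q r \<Longrightarrow> v \<in> carrier (obj M p) \<Longrightarrow> mor M q r (mor M p q v) = mor M p r v"
  using is_functor by (simp add: vec_functor_def)

lemma mor_zero: "leq p q \<Longrightarrow> mor M p q \<zero>\<^bsub>obj M p\<^esub> = \<zero>\<^bsub>obj M q\<^esub>"
proof -
  assume "leq p q"
  then interpret linear_map K "obj M p" "obj M q" "mor M p q"
    by (intro linear_mapI obj.vectorspace_axioms mor_hom)
  show ?thesis by (rule T0_is_0)
qed

lemma vectorspace_product_obj: "vectorspace K (product M S)"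
  by (intro vectorspace_product obj.field_axioms obj.vectorspace_axioms)

lemma module_product_obj: "module K (product M S)"
proof -
  interpret vectorspace K "product M S" by (rule vectorspace_product_obj)
  show ?thesis by (rule module_axioms)
qed

lemma vectorspace_product_subspace:
  "submodule K A (product M S) \<Longrightarrow> vectorspace K (product M S\<lparr>carrier := A\<rparr>)"
  by (intro vectorspace.subspace_is_vs subspace.intro vectorspace_product_obj)

lemma vectorspace_limit: "vectorspace K (limit leq M S)"
proof -
  define A where
    "A = {s \<in> \<Pi>\<^sub>E p\<in>S. carrier (obj M p). \<forall>p\<in>S. \<forall>q\<in>S. leq p q \<longrightarrow> mor M p q (s p) = s q}"
  have "submodule K A (product M S)"
  proof (rule submoduleI)
    show "A \<subseteq> carrier (product M S)"
      unfolding A_def product_simps by (rule Collect_restrict)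
    show "\<zero>\<^bsub>product M S\<^esub> \<in> A"
      unfolding A_def product_simps by (auto simp: mor_zero)
    show "s \<oplus>\<^bsub>product M S\<^esub> t \<in> A" if "s \<in> A" "t \<in> A" for s t
    proof -
      have "mor M p q (s p \<oplus>\<^bsub>obj M p\<^esub> t p) = s q \<oplus>\<^bsub>obj M q\<^esub> t q"
        if "p \<in> S" "q \<in> S" "leq p q" for p q
        using that \<open>s \<in> A\<close> \<open>t \<in> A\<close> by (simp add: A_def module_hom_add[OF mor_hom] PiE_iff)
      then show ?thesis
        using that by (simp add: A_def product_simps PiE_iff)
    qed
    show "c \<odot>\<^bsub>product M S\<^esub> s \<in> A" if "c \<in> carrier K" "s \<in> A" for c s
    proof -
      have "mor M p q (c \<odot>\<^bsub>obj M p\<^esub> s p) = c \<odot>\<^bsub>obj M q\<^esub> s q"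
        if "p \<in> S" "q \<in> S" "leq p q" for p q
        using that \<open>s \<in> A\<close> \<open>c \<in> carrier K\<close> by (simp add: A_def module_hom_smult[OF mor_hom] PiE_iff)
      then show ?thesis
        using that by (simp add: A_def product_simps PiE_iff)
    qed
  qed (rule module_product_obj)
  then have "vectorspace K (product M S\<lparr>carrier := A\<rparr>)"
    by (rule vectorspace_product_subspace)
  also have "product M S\<lparr>carrier := A\<rparr> = limit leq M S"
    by (simp add: A_def product_def limit_def)
  finally show ?thesis .
qed

lemma vectorspace_dsum: "vectorspace K (dsum M S)"
proof -
  define A where
    "A = {s \<in> \<Pi>\<^sub>E p\<in>S. carrier (obj M p). finite {p\<in>S. s p \<noteq> \<zero>\<^bsub>obj M p\<^esub>}}"
  have "submodule K A (product M S)"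
  proof (rule submoduleI)
    show "s \<oplus>\<^bsub>product M S\<^esub> t \<in> A" if "s \<in> A" "t \<in> A" for s t
    proof -
      have "finite ({p\<in>S. s p \<noteq> \<zero>\<^bsub>obj M p\<^esub>} \<union> {p\<in>S. t p \<noteq> \<zero>\<^bsub>obj M p\<^esub>})"
        using that by (auto simp: A_def)
      moreover have "{p\<in>S. s p \<oplus>\<^bsub>obj M p\<^esub> t p \<noteq> \<zero>\<^bsub>obj M p\<^esub>} \<subseteq> \<dots>"
        by auto
      ultimately have "finite {p\<in>S. s p \<oplus>\<^bsub>obj M p\<^esub> t p \<noteq> \<zero>\<^bsub>obj M p\<^esub>}"
        by (rule rev_finite_subset)
      moreover have "{p\<in>S. (\<lambda>p\<in>S. s p \<oplus>\<^bsub>obj M p\<^esub> t p) p \<noteq> \<zero>\<^bsub>obj M p\<^esub>} = {p\<in>S. s p \<oplus>\<^bsub>obj M p\<^esub> t p \<noteq> \<zero>\<^bsub>obj M p\<^esub>}"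
        by (rule Collect_cong) auto
      moreover have "(\<lambda>p\<in>S. s p \<oplus>\<^bsub>obj M p\<^esub> t p) \<in> (\<Pi>\<^sub>E p\<in>S. carrier (obj M p))"
        using that by (auto simp: A_def PiE_iff)
      ultimately show ?thesis
        unfolding A_def product_simps mem_Collect_eq by simp
    qed
    show "c \<odot>\<^bsub>product M S\<^esub> s \<in> A" if "c \<in> carrier K" "s \<in> A" for c s
    proof -
      have "finite {p\<in>S. c \<odot>\<^bsub>obj M p\<^esub> s p \<noteq> \<zero>\<^bsub>obj M p\<^esub>}"
        by (rule rev_finite_subset[of "{p\<in>S. s p \<noteq> \<zero>\<^bsub>obj M p\<^esub>}"]) (use that in \<open>auto simp: A_def\<close>)
      moreover have "{p\<in>S. (\<lambda>p\<in>S. c \<odot>\<^bsub>obj M p\<^esub> s p) p \<noteq> \<zero>\<^bsub>obj M p\<^esub>} = {p\<in>S. c \<odot>\<^bsub>obj M p\<^esub> s p \<noteq> \<zero>\<^bsub>obj M p\<^esub>}"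
        by (rule Collect_cong) auto
      moreover have "(\<lambda>p\<in>S. c \<odot>\<^bsub>obj M p\<^esub> s p) \<in> (\<Pi>\<^sub>E p\<in>S. carrier (obj M p))"
        using that by (auto simp: A_def PiE_iff)
      ultimately show ?thesis
        unfolding A_def product_simps mem_Collect_eq by simp
    qed
    show "A \<subseteq> carrier (product M S)"
      unfolding A_def product_simps by (rule Collect_restrict)
    show "\<zero>\<^bsub>product M S\<^esub> \<in> A"
      unfolding A_def product_simps by auto
  qed (rule module_product_obj)
  then have "vectorspace K (product M S\<lparr>carrier := A\<rparr>)"
    by (rule vectorspace_product_subspace)
  also have "product M S\<lparr>carrier := A\<rparr> = dsum M S"
    by (simp add: A_def product_def dsum_def)
  finally show ?thesis .
qed

sublocale dsum: vectorspace K "dsum M S" for S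
  by (rule vectorspace_dsum)

lemma dsum_inj_closed:
  assumes "v \<in> carrier (obj M p)"
  shows "dsum_inj M S p v \<in> carrier (dsum M S)"
proof -
  have "finite {r\<in>S. (if r = p then v else \<zero>\<^bsub>obj M r\<^esub>) \<noteq> \<zero>\<^bsub>obj M r\<^esub>}"
    by (rule finite_subset[of _ "{p}"]) auto
  then show ?thesis
    using assms by (auto simp: dsum_simps dsum_inj_def cong: conj_cong)
qed

lemma dsum_inj_hom: "dsum_inj M S p \<in> module_hom K (obj M p) (dsum M S)"
  by (rule module_homI) (auto simp: dsum_inj_closed, auto simp: dsum_simps dsum_inj_def intro!: restrict_ext)

lemma colim_gens_closed:
  "{dsum_inj M S p v \<ominus>\<^bsub>dsum M S\<^esub> dsum_inj M S q (mor M p q v) | p q v.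
      p \<in> S \<and> q \<in> S \<and> leq p q \<and> v \<in> carrier (obj M p)} \<subseteq> carrier (dsum M S)"
  by (auto intro!: dsum.minus_closed dsum_inj_closed mor_closed)

lemma submodule_colim_rel: "submodule K (colim_rel K leq M S) (dsum M S)"
  unfolding colim_rel_def by (rule dsum.span_is_submodule[OF colim_gens_closed])

text \<open>The colimit is by definition this quotient, so the coset lemmas apply to it for every
  index set \<open>S\<close>.\<close>

sublocale colim: quotient_space K "dsum M S" "colim_rel K leq M S" for S
  by (intro quotient_space.intro dsum.vectorspace_axioms submodule_colim_rel)

lemma vectorspace_colimit: "vectorspace K (colimit K leq M S)"
  unfolding colimit_def by (rule colim.vectorspace_quot_module)

lemma colim_inj_hom: "colim_inj K leq M S p \<in> module_hom K (obj M p) (colimit K leq M S)"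
  unfolding colimit_def colim_inj_def by (rule module_hom_comp[OF colim.coset_hom dsum_inj_hom])

lemma colim_inj_mor:
  assumes "p \<in> S" "q \<in> S" "leq p q" "v \<in> carrier (obj M p)"
  shows "colim_inj K leq M S q (mor M p q v) = colim_inj K leq M S p v"
proof -
  have "dsum_inj M S p v \<ominus>\<^bsub>dsum M S\<^esub> dsum_inj M S q (mor M p q v) \<in> colim_rel K leq M S"
    unfolding colim_rel_def using assms by (intro subsetD[OF dsum.in_own_span[OF colim_gens_closed]]) blast
  then show ?thesis
    unfolding colim_inj_def
    using assms by (intro colim.coset_eqI[symmetric] dsum_inj_closed mor_closed)
qed

text \<open>The kernel of \<open>f\<close> is a submodule. The cocone condition puts the generators
  of the relations into it, hence also their span.\<close>

lemma hom_colim_rel_zero: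
  assumes W: "vectorspace K W" and f: "f \<in> module_hom K (dsum M S) W"
    and cocone: "\<And>p q v. p \<in> S \<Longrightarrow> q \<in> S \<Longrightarrow> leq p q \<Longrightarrow> v \<in> carrier (obj M p) \<Longrightarrow>
      f (dsum_inj M S p v) = f (dsum_inj M S q (mor M p q v))"
    and x: "x \<in> colim_rel K leq M S"
  shows "f x = \<zero>\<^bsub>W\<^esub>"
proof -
  interpret W: vectorspace K W by (rule W)
  interpret f: linear_map K "dsum M S" W f
    by (intro linear_mapI vectorspace_dsum W f)
  have "colim_rel K leq M S \<subseteq> f.ker"
    unfolding colim_rel_def
  proof (rule dsum.span_is_subset[OF _ f.ker_is_submodule], clarify)
    fix p q v assume *: "p \<in> S" "q \<in> S" "leq p q" "v \<in> carrier (obj M p)"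
    have cl: "dsum_inj M S p v \<in> carrier (dsum M S)"
      "dsum_inj M S q (mor M p q v) \<in> carrier (dsum M S)"
      using * by (auto intro!: dsum_inj_closed mor_closed)
    have "f (dsum_inj M S p v \<ominus>\<^bsub>dsum M S\<^esub> dsum_inj M S q (mor M p q v)) = \<zero>\<^bsub>W\<^esub>"
      unfolding f.f_minus[OF cl] cocone[OF *]
      using f.f_im[OF cl(2)] by (simp add: a_minus_def abelian_group.r_neg[OF W.abelian_group_axioms])
    then show "dsum_inj M S p v \<ominus>\<^bsub>dsum M S\<^esub> dsum_inj M S q (mor M p q v) \<in> f.ker"
      using cl by (simp add: f.ker_def)
  qed
  then show ?thesis
    using x by (auto simp: f.ker_def)
qed

end

lemma hom_into_limit:
  assumes "\<And>p. p \<in> S \<Longrightarrow> g p \<in> module_hom K V (obj M p)"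
    and "\<And>p q x. p \<in> S \<Longrightarrow> q \<in> S \<Longrightarrow> leq p q \<Longrightarrow> x \<in> carrier V \<Longrightarrow> mor M p q (g p x) = g q x"
  shows "(\<lambda>x. \<lambda>p\<in>S. g p x) \<in> module_hom K V (limit leq M S)"
proof (rule module_homI)
  fix x assume x: "x \<in> carrier V"
  have "g p x \<in> carrier (obj M p)" if "p \<in> S" for p
    using module_hom_closed[OF assms(1)[OF that]] x by (rule funcset_mem)
  then show "(\<lambda>p\<in>S. g p x) \<in> carrier (limit leq M S)"
    using assms(2) x by (simp add: limit_simps)
  show "(\<lambda>p\<in>S. g p (c \<odot>\<^bsub>V\<^esub> x)) = c \<odot>\<^bsub>limit leq M S\<^esub> (\<lambda>p\<in>S. g p x)"
    if "c \<in> carrier K" for c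
    unfolding limit_simps using that x by (intro restrict_ext) (simp add: module_hom_smult[OF assms(1)])
  fix y assume y: "y \<in> carrier V"
  show "(\<lambda>p\<in>S. g p (x \<oplus>\<^bsub>V\<^esub> y)) = (\<lambda>p\<in>S. g p x) \<oplus>\<^bsub>limit leq M S\<^esub> (\<lambda>p\<in>S. g p y)"
    unfolding limit_simps using x y by (intro restrict_ext) (simp add: module_hom_add[OF assms(1)])
qed

lemma limit_eval_hom: "p \<in> S \<Longrightarrow> (\<lambda>s. s p) \<in> module_hom K (limit leq M S) (obj M p)"
  by (rule module_homI) (auto simp: limit_simps)

section \<open>The universal property of the colimit\<close>

context vec_diagram
begin

text \<open>Elements of the direct sum have finite support. The induction runs over a finite set
  containing the support and splits off one coordinate at a time.\<close>

lemma dsum_induct [consumes 1, case_names zero add]: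
  assumes x: "x \<in> carrier (dsum M S)" and zero: "P \<zero>\<^bsub>dsum M S\<^esub>"
    and add: "\<And>p v x. p \<in> S \<Longrightarrow> v \<in> carrier (obj M p) \<Longrightarrow> x \<in> carrier (dsum M S) \<Longrightarrow> P x \<Longrightarrow>
      P (dsum_inj M S p v \<oplus>\<^bsub>dsum M S\<^esub> x)"
  shows "P x"
proof -
  have "P x" if "finite A" "x \<in> carrier (dsum M S)" "A \<subseteq> S" "\<And>p. p \<in> S - A \<Longrightarrow> x p = \<zero>\<^bsub>obj M p\<^esub>" for A x
    using that
  proof (induction A arbitrary: x rule: finite_induct)
    case empty
    then have "x = \<zero>\<^bsub>dsum M S\<^esub>"
      by (auto simp: dsum_simps fun_eq_iff PiE_iff extensional_def)
    then show ?case using zero by simp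
  next
    case (insert q A)
    define y where "y = x(q := \<zero>\<^bsub>obj M q\<^esub>)"
    have q: "q \<in> S" and x: "x \<in> (\<Pi>\<^sub>E p\<in>S. carrier (obj M p))"
      and fin: "finite {p\<in>S. x p \<noteq> \<zero>\<^bsub>obj M p\<^esub>}"
      using insert.prems by (auto simp: dsum_simps)
    have "finite {p\<in>S. y p \<noteq> \<zero>\<^bsub>obj M p\<^esub>}"
      by (rule finite_subset[OF _ fin]) (auto simp: y_def)
    moreover have "y \<in> (\<Pi>\<^sub>E p\<in>S. carrier (obj M p))"
      using x q by (auto simp: y_def PiE_iff extensional_def)
    ultimately have y: "y \<in> carrier (dsum M S)"
      by (simp add: dsum_simps)
    moreover have "P y"
    proof (rule insert.IH[OF y])
      show "y p = \<zero>\<^bsub>obj M p\<^esub>" if "p \<in> S - A" for p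
        using insert.prems(3)[of p] that by (auto simp: y_def)
    qed (use insert.prems in auto)
    moreover have "x = dsum_inj M S q (x q) \<oplus>\<^bsub>dsum M S\<^esub> y"
      using x q by (auto simp: dsum_simps dsum_inj_def y_def fun_eq_iff PiE_iff extensional_def)
    ultimately show ?case
      using add[of q "x q" y] q PiE_mem[OF x q] by simp
  qed
  moreover have "finite {p\<in>S. x p \<noteq> \<zero>\<^bsub>obj M p\<^esub>}"
    using x by (simp add: dsum_simps)
  ultimately show ?thesis
    using x by (metis (mono_tags, lifting) DiffE mem_Collect_eq subsetI)
qed

text \<open>Uniqueness half of the universal property: by \<open>dsum_induct\<close>, every
  representative of an element of the colimit is a sum of vectors coming from single spaces.\<close>

lemma colimit_hom_eqI:
  assumes W: "vectorspace K W"
    and F: "F \<in> module_hom K (colimit K leq M S) W" and G: "G \<in> module_hom K (colimit K leq M S) W"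
    and eq: "\<And>p v. p \<in> S \<Longrightarrow> v \<in> carrier (obj M p) \<Longrightarrow>
      F (colim_inj K leq M S p v) = G (colim_inj K leq M S p v)"
    and X: "X \<in> carrier (colimit K leq M S)"
  shows "F X = G X"
proof -
  define c where "c x = colim_rel K leq M S +>\<^bsub>dsum M S\<^esub> x" for x
  have c: "c \<in> module_hom K (dsum M S) (colimit K leq M S)"
    unfolding c_def colimit_def by (rule colim.coset_hom)
  interpret F: linear_map K "dsum M S" W "\<lambda>x. F (c x)"
    by (intro linear_mapI vectorspace_dsum W module_hom_comp[OF F c])
  interpret G: linear_map K "dsum M S" W "\<lambda>x. G (c x)"
    by (intro linear_mapI vectorspace_dsum W module_hom_comp[OF G c])
  obtain x where x: "x \<in> carrier (dsum M S)" and X: "X = c x"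
    using X unfolding colimit_def colim.carrier_quot_module c_def by blast
  from x have "F (c x) = G (c x)"
  proof (induction rule: dsum_induct)
    case zero
    show ?case by (simp only: F.T0_is_0 G.T0_is_0)
  next
    case (add p v x)
    note i = dsum_inj_closed[OF add(2), of S]
    have "F (c (dsum_inj M S p v)) = G (c (dsum_inj M S p v))"
      using eq[OF add(1,2)] by (simp add: c_def colim_inj_def)
    then show ?case
      by (simp only: F.T_add[OF i add(3)] G.T_add[OF i add(3)] add(4))
  qed
  then show ?thesis by (simp only: X)
qed

end

text \<open>Existence half of the universal property, with \<open>h\<close> as the cocone. The sum
  runs over all of \<open>S\<close>, so this is the intended map for finite \<open>S\<close>; that
  covers the boxes and the sets \<open>below u\<close>.\<close>

definition colim_desc :: "('k, 'w, 'd) module_scheme \<Rightarrow> 'p set \<Rightarrow> ('p \<Rightarrow> 'v \<Rightarrow> 'w) \<Rightarrow> ('p \<Rightarrow> 'v) set \<Rightarrow> 'w" where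
  "colim_desc W S h = quot_lift (\<lambda>x. \<Oplus>\<^bsub>W\<^esub>p\<in>S. h p (x p))"

context vec_diagram
begin

context
  fixes S W h
  assumes S: "finite S" and W: "vectorspace K W"
    and h: "\<And>p. p \<in> S \<Longrightarrow> h p \<in> module_hom K (obj M p) W"
    and cocone: "\<And>p q v. p \<in> S \<Longrightarrow> q \<in> S \<Longrightarrow> leq p q \<Longrightarrow> v \<in> carrier (obj M p) \<Longrightarrow>
      h q (mor M p q v) = h p v"
begin

interpretation W: vectorspace K W by (rule W)

lemma dsum_cocone_closed:
  "x \<in> carrier (dsum M S) \<Longrightarrow> (\<lambda>p. h p (x p)) \<in> S \<rightarrow> carrier W"
  using module_hom_closed[OF h] by (auto simp: dsum_simps PiE_iff Pi_iff)

lemma dsum_cocone_hom: "(\<lambda>x. \<Oplus>\<^bsub>W\<^esub>p\<in>S. h p (x p)) \<in> module_hom K (dsum M S) W"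
proof (rule module_homI)
  fix x assume x: "x \<in> carrier (dsum M S)"
  note hx = dsum_cocone_closed[OF x]
  show "(\<Oplus>\<^bsub>W\<^esub>p\<in>S. h p (x p)) \<in> carrier W"
    by (rule W.finsum_closed[OF hx])
  show "(\<Oplus>\<^bsub>W\<^esub>p\<in>S. h p ((c \<odot>\<^bsub>dsum M S\<^esub> x) p)) = c \<odot>\<^bsub>W\<^esub> (\<Oplus>\<^bsub>W\<^esub>p\<in>S. h p (x p))"
    if c: "c \<in> carrier K" for c
  proof -
    have "h p ((c \<odot>\<^bsub>dsum M S\<^esub> x) p) = c \<odot>\<^bsub>W\<^esub> h p (x p)" if "p \<in> S" for p
      using that module_hom_smult[OF h c] x by (simp add: dsum_simps PiE_iff)
    then have "(\<Oplus>\<^bsub>W\<^esub>p\<in>S. h p ((c \<odot>\<^bsub>dsum M S\<^esub> x) p)) = (\<Oplus>\<^bsub>W\<^esub>p\<in>S. c \<odot>\<^bsub>W\<^esub> h p (x p))"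
      using hx c by (intro W.finsum_cong') (auto simp: Pi_iff)
    then show ?thesis
      using W.finsum_smult[OF c hx] by simp
  qed
  fix y assume y: "y \<in> carrier (dsum M S)"
  note hy = dsum_cocone_closed[OF y]
  have "h p ((x \<oplus>\<^bsub>dsum M S\<^esub> y) p) = h p (x p) \<oplus>\<^bsub>W\<^esub> h p (y p)" if "p \<in> S" for p
    using that module_hom_add[OF h] x y by (simp add: dsum_simps PiE_iff)
  then have "(\<Oplus>\<^bsub>W\<^esub>p\<in>S. h p ((x \<oplus>\<^bsub>dsum M S\<^esub> y) p)) = (\<Oplus>\<^bsub>W\<^esub>p\<in>S. h p (x p) \<oplus>\<^bsub>W\<^esub> h p (y p))"
    using hx hy by (intro W.finsum_cong') (auto simp: Pi_iff)
  then show "(\<Oplus>\<^bsub>W\<^esub>p\<in>S. h p ((x \<oplus>\<^bsub>dsum M S\<^esub> y) p)) =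
      (\<Oplus>\<^bsub>W\<^esub>p\<in>S. h p (x p)) \<oplus>\<^bsub>W\<^esub> (\<Oplus>\<^bsub>W\<^esub>p\<in>S. h p (y p))"
    using W.finsum_addf[OF hx hy] by simp
qed

lemma dsum_cocone_inj:
  assumes p: "p \<in> S" and v: "v \<in> carrier (obj M p)"
  shows "(\<Oplus>\<^bsub>W\<^esub>r\<in>S. h r (dsum_inj M S p v r)) = h p v"
proof -
  have 0: "h r \<zero>\<^bsub>obj M r\<^esub> = \<zero>\<^bsub>W\<^esub>" if "r \<in> S" for r
  proof -
    interpret linear_map K "obj M r" W "h r"
      by (intro linear_mapI obj.vectorspace_axioms W h that)
    show ?thesis by (rule T0_is_0)
  qed
  have hv: "h p v \<in> carrier W"
    using module_hom_closed[OF h[OF p]] v by (rule funcset_mem)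
  have "(\<Oplus>\<^bsub>W\<^esub>r\<in>S. h r (dsum_inj M S p v r)) = (\<Oplus>\<^bsub>W\<^esub>r\<in>S. if p = r then h p v else \<zero>\<^bsub>W\<^esub>)"
    using hv 0 by (intro W.finsum_cong') (auto simp: dsum_inj_def)
  also have "\<dots> = h p v"
    using W.finsum_singleton[OF p S, of "\<lambda>_. h p v"] hv by auto
  finally show ?thesis .
qed

lemma dsum_cocone_zero:
  assumes "x \<in> colim_rel K leq M S"
  shows "(\<Oplus>\<^bsub>W\<^esub>p\<in>S. h p (x p)) = \<zero>\<^bsub>W\<^esub>"
proof (rule hom_colim_rel_zero[OF W dsum_cocone_hom _ assms])
  fix p q v assume *: "p \<in> S" "q \<in> S" "leq p q" "v \<in> carrier (obj M p)"
  then show "(\<Oplus>\<^bsub>W\<^esub>r\<in>S. h r (dsum_inj M S p v r)) = (\<Oplus>\<^bsub>W\<^esub>r\<in>S. h r (dsum_inj M S q (mor M p q v) r))"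
    using dsum_cocone_inj[OF *(1,4)] dsum_cocone_inj[OF *(2) mor_closed[OF *(3,4)]] cocone[OF *]
    by simp
qed

lemma colim_desc_hom: "colim_desc W S h \<in> module_hom K (colimit K leq M S) W"
  unfolding colim_desc_def colimit_def
  by (rule colim.quot_lift_hom[OF W dsum_cocone_hom dsum_cocone_zero])

lemma colim_desc_inj:
  assumes "p \<in> S" "v \<in> carrier (obj M p)"
  shows "colim_desc W S h (colim_inj K leq M S p v) = h p v"
  unfolding colim_desc_def colim_inj_def
  using colim.quot_lift_coset[OF W dsum_cocone_hom dsum_cocone_zero dsum_inj_closed[OF assms(2)]]
    dsum_cocone_inj[OF assms] by simp

end

section \<open>The canonical map from limit to colimit\<close>

lemma lim_to_colim_hom:
  assumes "S \<noteq> {}"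
  shows "lim_to_colim K leq M S \<in> module_hom K (limit leq M S) (colimit K leq M S)"
proof -
  have "(SOME p. p \<in> S) \<in> S"
    using assms by (simp add: some_in_eq)
  then show ?thesis
    unfolding lim_to_colim_def Let_def by (intro module_hom_comp[OF colim_inj_hom limit_eval_hom])
qed

text \<open>The map passes through the one space \<open>M p\<close> at the index chosen in
  \<open>lim_to_colim\<close>. Its image therefore lies in the image of a finite-dimensional space,
  whatever the size of \<open>S\<close>.\<close>

lemma fin_dim_lim_to_colim:
  assumes "S \<noteq> {}"
  shows "vectorspace.fin_dim K
    ((colimit K leq M S)\<lparr>carrier := lim_to_colim K leq M S ` carrier (limit leq M S)\<rparr>)"
proof -
  define p where "p = (SOME p. p \<in> S)"
  define A where "A = colim_inj K leq M S p ` carrier (obj M p)"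
  let ?B = "lim_to_colim K leq M S ` carrier (limit leq M S)"
  have p: "p \<in> S"
    using assms by (simp add: some_in_eq p_def)
  interpret C: vectorspace K "colimit K leq M S" by (rule vectorspace_colimit)
  interpret i: linear_map K "obj M p" "colimit K leq M S" "colim_inj K leq M S p"
    by (intro linear_mapI obj.vectorspace_axioms vectorspace_colimit colim_inj_hom)
  interpret T: linear_map K "limit leq M S" "colimit K leq M S" "lim_to_colim K leq M S"
    by (intro linear_mapI vectorspace_limit vectorspace_colimit lim_to_colim_hom assms)
  have "subspace K A (colimit K leq M S)"
    using i.imT_is_subspace by (simp add: i.im_def A_def)
  then interpret A: vectorspace K "(colimit K leq M S)\<lparr>carrier := A\<rparr>"
    by (rule C.subspace_is_vs)
  have "subspace K ?B (colimit K leq M S)"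
    using T.imT_is_subspace by (simp add: T.im_def)
  moreover have "?B \<subseteq> A"
    using p by (auto simp: A_def lim_to_colim_def limit_simps PiE_iff simp flip: p_def)
  ultimately have "subspace K ?B ((colimit K leq M S)\<lparr>carrier := A\<rparr>)"
    by (auto simp: subspace_def submodule_def A.vectorspace_axioms A.module_axioms)
  then show ?thesis
    using A.subspace_fin_dim_le(1) i.fin_dim_image(1)[OF fin_dim] by (simp add: A_def)
qed

lemma colim_inj_compat:
  assumes "s \<in> carrier (limit leq M A)" "p \<in> A" "q \<in> A" "A \<subseteq> S" "leq p q"
  shows "colim_inj K leq M S q (s q) = colim_inj K leq M S p (s p)"
proof -
  have "s p \<in> carrier (obj M p)" "s q = mor M p q (s p)"
    using assms by (auto simp: limit_simps PiE_iff)
  then show ?thesis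
    using colim_inj_mor[of p S q "s p"] assms by auto
qed

text \<open>Consecutive integers are comparable in the zigzag order in one direction or the other,
  so \<open>colim_inj_compat\<close> handles each step of the path. The family may live on a set
  \<open>A\<close> smaller than \<open>S\<close>, since segments of a row will be mapped into the
  colimit over \<open>below u\<close>.\<close>

lemma colim_inj_path:
  assumes s: "s \<in> carrier (limit leq M A)" and AS: "A \<subseteq> S"
    and F: "\<And>i j. zz_le i j \<Longrightarrow> leq (F i) (F j)"
    and cd: "c \<le> d" "F ` {c..d} \<subseteq> A"
  shows "colim_inj K leq M S (F d) (s (F d)) = colim_inj K leq M S (F c) (s (F c))"
  using cd
proof (induction d rule: int_ge_induct)
  case (step i)
  have i: "F i \<in> A" "F (i + 1) \<in> A"
    using step.hyps step.prems by auto
  have "zz_le i (i + 1) \<or> zz_le (i + 1) i"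
    by (auto simp: zz_le_def)
  then have "colim_inj K leq M S (F (i + 1)) (s (F (i + 1))) = colim_inj K leq M S (F i) (s (F i))"
    using colim_inj_compat[OF s i AS F] colim_inj_compat[OF s i(2,1) AS F] by auto
  also have "\<dots> = colim_inj K leq M S (F c) (s (F c))"
    using step.prems by (intro step.IH) auto
  finally show ?case .
qed simp

end

text \<open>Families are extended by zero from \<open>S\<close> to \<open>T\<close>; by naturality
  the relations go to zero, so the map descends to the quotient. This covers both kinds of maps
  between left Kan extensions: inclusions of index sets with identity components, and morphisms over
  a fixed index set.\<close>

lemma colim_map_hom_inj:
  assumes M: "vec_diagram K leq M" and N: "vec_diagram K leq N" and ST: "S \<subseteq> T"
    and f: "\<And>p. p \<in> S \<Longrightarrow> f p \<in> module_hom K (obj M p) (obj N p)"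
    and nat: "\<And>p q v. p \<in> S \<Longrightarrow> q \<in> S \<Longrightarrow> leq p q \<Longrightarrow> v \<in> carrier (obj M p) \<Longrightarrow>
      f q (mor M p q v) = mor N p q (f p v)"
  shows "colim_map K leq S N T f \<in> module_hom K (colimit K leq M S) (colimit K leq N T)"
    and "p \<in> S \<Longrightarrow> v \<in> carrier (obj M p) \<Longrightarrow>
      colim_map K leq S N T f (colim_inj K leq M S p v) = colim_inj K leq N T p (f p v)"
proof -
  interpret M: vec_diagram K leq M by (rule M)
  interpret N: vec_diagram K leq N by (rule N)
  define e where "e x = (\<lambda>p\<in>T. if p \<in> S then f p (x p) else \<zero>\<^bsub>obj N p\<^esub>)" for x
  define g where "g x = colim_rel K leq N T +>\<^bsub>dsum N T\<^esub> e x" for x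
  have f0: "f p \<zero>\<^bsub>obj M p\<^esub> = \<zero>\<^bsub>obj N p\<^esub>" if "p \<in> S" for p
  proof -
    interpret linear_map K "obj M p" "obj N p" "f p"
      by (intro linear_mapI M.obj.vectorspace_axioms N.obj.vectorspace_axioms f that)
    show ?thesis by (rule T0_is_0)
  qed
  have fc: "f p v \<in> carrier (obj N p)" if "p \<in> S" "v \<in> carrier (obj M p)" for p v
    using module_hom_closed[OF f] that by (auto simp: Pi_iff)
  have e: "e \<in> module_hom K (dsum M S) (dsum N T)"
  proof (rule module_homI)
    fix x assume x: "x \<in> carrier (dsum M S)"
    then have fin: "finite {p\<in>S. x p \<noteq> \<zero>\<^bsub>obj M p\<^esub>}" and xc: "\<And>p. p \<in> S \<Longrightarrow> x p \<in> carrier (obj M p)"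
      by (auto simp: dsum_simps)
    have "finite {p\<in>T. e x p \<noteq> \<zero>\<^bsub>obj N p\<^esub>}"
      by (rule finite_subset[OF _ fin]) (auto simp: e_def f0 split: if_splits)
    moreover have "e x \<in> (\<Pi>\<^sub>E p\<in>T. carrier (obj N p))"
      unfolding e_def using fc xc by (auto simp: PiE_iff)
    ultimately show "e x \<in> carrier (dsum N T)"
      by (simp add: dsum_simps)
    show "e (c \<odot>\<^bsub>dsum M S\<^esub> x) = c \<odot>\<^bsub>dsum N T\<^esub> e x" if "c \<in> carrier K" for c
      using that xc unfolding dsum_simps e_def
      by (intro restrict_ext) (auto simp: module_hom_smult[OF f])
    fix y assume y: "y \<in> carrier (dsum M S)"
    then have yc: "\<And>p. p \<in> S \<Longrightarrow> y p \<in> carrier (obj M p)"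
      by (auto simp: dsum_simps)
    show "e (x \<oplus>\<^bsub>dsum M S\<^esub> y) = e x \<oplus>\<^bsub>dsum N T\<^esub> e y"
      using xc yc unfolding dsum_simps e_def
      by (intro restrict_ext) (auto simp: module_hom_add[OF f])
  qed
  have g: "g \<in> module_hom K (dsum M S) (colimit K leq N T)"
    unfolding g_def colimit_def by (rule module_hom_comp[OF N.colim.coset_hom e])
  have g_inj: "g (dsum_inj M S p v) = colim_inj K leq N T p (f p v)"
    if "p \<in> S" "v \<in> carrier (obj M p)" for p v
  proof -
    have "e (dsum_inj M S p v) = dsum_inj N T p (f p v)"
      unfolding e_def dsum_inj_def using that by (intro restrict_ext) (auto simp: f0)
    then show ?thesis
      by (simp add: g_def colim_inj_def)
  qed
  have g0: "g x = \<zero>\<^bsub>colimit K leq N T\<^esub>" if "x \<in> colim_rel K leq M S" for x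
  proof (rule M.hom_colim_rel_zero[OF N.vectorspace_colimit g _ that])
    fix p q v assume *: "p \<in> S" "q \<in> S" "leq p q" "v \<in> carrier (obj M p)"
    show "g (dsum_inj M S p v) = g (dsum_inj M S q (mor M p q v))"
      unfolding g_inj[OF *(1,4)] g_inj[OF *(2) M.mor_closed[OF *(3,4)]] nat[OF *]
      using * ST by (intro N.colim_inj_mor[symmetric] fc) auto
  qed
  \<comment> \<open>\<open>colim_map\<close> is a union over representatives. As \<open>g\<close> is
    constant on the coset, the union is this one value, and \<open>colim_map\<close> agrees with the
    lift of \<open>g\<close>.\<close>
  have map: "colim_map K leq S N T f (colim_rel K leq M S +>\<^bsub>dsum M S\<^esub> x) = g x"
    if x: "x \<in> carrier (dsum M S)" for x
  proof -
    have "g y = g x" if "y \<in> colim_rel K leq M S +>\<^bsub>dsum M S\<^esub> x" for y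
      by (intro M.colim.hom_coset_eq[OF N.vectorspace_colimit g _ x that] g0)
    moreover have "colim_rel K leq M S +>\<^bsub>dsum M S\<^esub> x \<noteq> {}"
      using M.colim.a_rcos_self[OF x] by blast
    ultimately have "(\<Union>y\<in>colim_rel K leq M S +>\<^bsub>dsum M S\<^esub> x. g y) = g x"
      by (intro SUP_eq_const)
    then show ?thesis
      unfolding colim_map_def g_def e_def .
  qed
  show "colim_map K leq S N T f \<in> module_hom K (colimit K leq M S) (colimit K leq N T)"
  proof (rule module_hom_cong)
    show "module K (colimit K leq M S)"
      using M.vectorspace_colimit by (rule vectorspace.axioms(1))
    show "quot_lift g \<in> module_hom K (colimit K leq M S) (colimit K leq N T)"
      unfolding colimit_def[of K leq M] by (intro M.colim.quot_lift_hom[OF N.vectorspace_colimit g] g0)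
    fix X assume "X \<in> carrier (colimit K leq M S)"
    then obtain x where x: "x \<in> carrier (dsum M S)" and X: "X = colim_rel K leq M S +>\<^bsub>dsum M S\<^esub> x"
      unfolding colimit_def M.colim.carrier_quot_module by blast
    have "quot_lift g X = g x"
      unfolding X by (intro M.colim.quot_lift_coset[OF N.vectorspace_colimit g _ x] g0)
    then show "colim_map K leq S N T f X = quot_lift g X"
      using map[OF x] by (simp add: X)
  qed
  show "colim_map K leq S N T f (colim_inj K leq M S p v) = colim_inj K leq N T p (f p v)"
    if "p \<in> S" "v \<in> carrier (obj M p)"
    using map[OF M.dsum_inj_closed[OF that(2)]] g_inj[OF that] by (simp add: colim_inj_def)
qed

section \<open>Zigzag diagrams and their block extensions\<close>

text \<open>\<open>below u\<close> and \<open>above u\<close> are the index sets of the left and the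
  right Kan extension at \<open>u\<close>. They are written with \<open>UNIV\<close> and
  \<open>id\<close> so that the unfolded \<open>Lan\<close> and \<open>Ran\<close> match them
  literally.\<close>

definition below :: "int \<times> int \<Rightarrow> int set" where
  "below u = {i \<in> UNIV. opz_le (iota i) u}"

definition above :: "int \<times> int \<Rightarrow> (int \<times> int) set" where
  "above u = {w \<in> U. opz_le u (id w)}"

text \<open>An odd \<open>i\<close> is sent to \<open>(i + 1, i - 1)\<close>. For
  \<open>p \<le> q\<close> the set is thus \<open>{p..q}\<close> together with \<open>p - 1\<close>
  and \<open>q + 1\<close> whenever these are odd. An overhanging source has only one of its two
  sinks in the set, so it does not change the colimit, but the maps below have to account for
  it.\<close>

lemma in_below:
  "i \<in> below (p, q) \<longleftrightarrow> (if even i then p \<le> i \<and> i \<le> q else p \<le> i + 1 \<and> i \<le> q + 1)"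
  by (auto simp: below_def iota_def)

lemma in_above: "(p, q) \<in> above (a, b) \<longleftrightarrow> p \<le> q \<and> p \<le> a \<and> b \<le> q"
  by (auto simp: above_def U_def)

lemma finite_below: "finite (below u)"
proof (cases u)
  case (Pair p q)
  have "below u \<subseteq> {p - 1..q + 1}"
    by (auto simp: Pair in_below split: if_splits)
  then show ?thesis
    by (rule finite_subset) simp
qed

lemma below_mono: "opz_le u u' \<Longrightarrow> below u \<subseteq> below u'"
  by (cases u; cases u') (auto simp: in_below split: if_splits)

abbreviation row :: "('k, 'm) ring_scheme \<Rightarrow> (int \<times> int, 'k, 'v) pmod \<Rightarrow> int
    \<Rightarrow> (int \<times> int, 'k, (int \<Rightarrow> 'v) set) pmod" where
  "row K M z \<equiv> Lan K UNIV zz_le opz_le iota (slice M z)"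

abbreviation row_inj where
  "row_inj K M z u \<equiv> colim_inj K zz_le (slice M z) (below u)"

definition push where
  "push K M z z' u = colim_map K zz_le (below u) (slice M z') (below u) (\<lambda>i. mor M (i, z) (i, z'))"

lemma obj_row: "obj (row K M z) u = colimit K zz_le (slice M z) (below u)"
  by (simp add: Lan_def below_def)

lemma mor_row:
  "mor (row K M z) u u' = colim_map K zz_le (below u) (slice M z) (below u') (\<lambda>_ v. v)"
  by (simp add: Lan_def below_def)

lemma obj_block: "obj (ext_block_ext K M) (a, b, z) = limit opz_le (row K M z) (above (a, b))"
  by (simp add: ext_block_ext_def block_ext_def Ran_def above_def)

text \<open>Along the first two coordinates a family is merely restricted to the new set
  \<open>above (a', b')\<close>; along the third, \<open>push\<close> acts on each
  component.\<close>

lemma mor_block: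
  "mor (ext_block_ext K M) (a, b, z) (a', b', z') t = (\<lambda>u\<in>above (a', b'). push K M z z' u (t u))"
  by (auto simp: ext_block_ext_def block_ext_def block_ext_map_def Ran_def Ran_map_def lim_map_def
    Lan_map_def push_def above_def below_def intro!: restrict_ext)

lemma obj_slice: "obj (slice M z) i = obj M (i, z)"
  and mor_slice: "mor (slice M z) i j = mor M (i, z) (j, z)"
  by (simp_all add: slice_def)

lemma zz_le_refl: "zz_le i i"
  by (simp add: zz_le_def)

section \<open>Rows of an extended zigzag module and their colimits\<close>

locale ezz_diagram = vec_diagram K ezz_le M
  for K :: "('k, 'm) ring_scheme" and M :: "(int \<times> int, 'k, 'v) pmod"
begin

lemma vec_functor_slice: "vec_functor K zz_le (slice M z)"
  using is_functor unfolding vec_functor_def by (auto simp: slice_def)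

sublocale slice: vec_diagram K zz_le "slice M z" for z
  by (rule vec_diagram.intro) (rule vec_functor_slice)

lemma row_inj_hom: "row_inj K M z u i \<in> module_hom K (obj M (i, z)) (obj (row K M z) u)"
  using slice.colim_inj_hom unfolding obj_row obj_slice .

lemma vectorspace_row: "vectorspace K (obj (row K M z) u)"
  unfolding obj_row by (rule slice.vectorspace_colimit)

lemma row_inj_mor:
  "i \<in> below u \<Longrightarrow> j \<in> below u \<Longrightarrow> zz_le i j \<Longrightarrow> v \<in> carrier (obj M (i, z)) \<Longrightarrow>
    row_inj K M z u j (mor M (i, z) (j, z) v) = row_inj K M z u i v"
  using slice.colim_inj_mor[where z = z] by (simp add: obj_slice mor_slice)

lemma row_hom_eqI:
  assumes "vectorspace K W" "F \<in> module_hom K (obj (row K M z) u) W" "G \<in> module_hom K (obj (row K M z) u) W"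
    and "\<And>i v. i \<in> below u \<Longrightarrow> v \<in> carrier (obj M (i, z)) \<Longrightarrow>
      F (row_inj K M z u i v) = G (row_inj K M z u i v)"
    and "X \<in> carrier (obj (row K M z) u)"
  shows "F X = G X"
  using assms unfolding obj_row by (intro slice.colimit_hom_eqI[of W F z "below u" G X]) (auto simp: obj_slice)

lemma push_hom_inj:
  assumes "z \<le> z'"
  shows "push K M z z' u \<in> module_hom K (obj (row K M z) u) (obj (row K M z') u)"
    and "i \<in> below u \<Longrightarrow> v \<in> carrier (obj M (i, z)) \<Longrightarrow>
      push K M z z' u (row_inj K M z u i v) = row_inj K M z' u i (mor M (i, z) (i, z') v)"
proof -
  have hom: "mor M (i, z) (i, z') \<in> module_hom K (obj (slice M z) i) (obj (slice M z') i)" for i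
    unfolding obj_slice using assms by (intro mor_hom) (simp add: zz_le_refl)
  have nat: "mor M (j, z) (j, z') (mor (slice M z) i j v) = mor (slice M z') i j (mor M (i, z) (i, z') v)"
    if "zz_le i j" "v \<in> carrier (obj (slice M z) i)" for i j v
    using that assms by (simp add: obj_slice mor_slice mor_mor zz_le_refl)
  note * = colim_map_hom_inj[OF slice.vec_diagram_axioms[of z] slice.vec_diagram_axioms[of z'] subset_refl,
      where f = "\<lambda>i. mor M (i, z) (i, z')" and S = "below u", OF hom nat]
  show "push K M z z' u \<in> module_hom K (obj (row K M z) u) (obj (row K M z') u)"
    unfolding push_def obj_row by (rule *(1))
  show "push K M z z' u (row_inj K M z u i v) = row_inj K M z' u i (mor M (i, z) (i, z') v)"
    if "i \<in> below u" "v \<in> carrier (obj M (i, z))"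
    using *(2)[of i v] that by (simp add: push_def obj_slice)
qed

lemma row_mor_hom_inj:
  assumes "opz_le u u'"
  shows "mor (row K M z) u u' \<in> module_hom K (obj (row K M z) u) (obj (row K M z) u')"
    and "i \<in> below u \<Longrightarrow> v \<in> carrier (obj M (i, z)) \<Longrightarrow>
      mor (row K M z) u u' (row_inj K M z u i v) = row_inj K M z u' i v"
proof -
  have hom: "(\<lambda>v. v) \<in> module_hom K (obj (slice M z) i) (obj (slice M z) i)" for i
    by (rule module_homI) auto
  note * = colim_map_hom_inj[OF slice.vec_diagram_axioms[of z] slice.vec_diagram_axioms[of z] below_mono[OF assms],
      where f = "\<lambda>_ v. v", OF hom refl]
  show "mor (row K M z) u u' \<in> module_hom K (obj (row K M z) u) (obj (row K M z) u')"
    unfolding mor_row obj_row by (rule *(1))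
  show "mor (row K M z) u u' (row_inj K M z u i v) = row_inj K M z u' i v"
    if "i \<in> below u" "v \<in> carrier (obj M (i, z))"
    using *(2)[of i v] that by (simp add: mor_row obj_slice)
qed

lemma block_closed:
  "t \<in> carrier (obj (ext_block_ext K M) (a, b, z)) \<Longrightarrow> u \<in> above (a, b) \<Longrightarrow> t u \<in> carrier (obj (row K M z) u)"
  unfolding obj_block limit_simps by (auto simp: PiE_iff)

lemma block_compat:
  "t \<in> carrier (obj (ext_block_ext K M) (a, b, z)) \<Longrightarrow> u \<in> above (a, b) \<Longrightarrow> u' \<in> above (a, b) \<Longrightarrow>
    opz_le u u' \<Longrightarrow> mor (row K M z) u u' (t u) = t u'"
  unfolding obj_block limit_simps by blast

text \<open>Restriction of families composes trivially. What remains is that \<open>push\<close>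
  composes on each row colimit, and this is checked on the vectors generating it.\<close>

lemma block_mor_mor:
  assumes t: "t \<in> carrier (obj (ext_block_ext K M) (a, b, z))"
    and le: "opzz_le (a, b, z) (a', b', z')" "opzz_le (a', b', z') (a'', b'', z'')"
  shows "mor (ext_block_ext K M) (a', b', z') (a'', b'', z'') (mor (ext_block_ext K M) (a, b, z) (a', b', z') t)
    = mor (ext_block_ext K M) (a, b, z) (a'', b'', z'') t"
  unfolding mor_block
proof (rule restrict_ext)
  fix u assume u: "u \<in> above (a'', b'')"
  have z: "z \<le> z'" "z' \<le> z''" "z \<le> z''"
    using le by auto
  have u': "u \<in> above (a', b')" "u \<in> above (a, b)"
    using u le by (cases u; auto simp: in_above)+
  have "push K M z' z'' u (push K M z z' u (t u)) = push K M z z'' u (t u)"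
  proof (rule row_hom_eqI[OF vectorspace_row _ _ _ block_closed[OF t u'(2)]])
    show "(\<lambda>X. push K M z' z'' u (push K M z z' u X)) \<in> module_hom K (obj (row K M z) u) (obj (row K M z'') u)"
      by (rule module_hom_comp[OF push_hom_inj(1)[OF z(2)] push_hom_inj(1)[OF z(1)]])
    show "push K M z z'' u \<in> module_hom K (obj (row K M z) u) (obj (row K M z'') u)"
      by (rule push_hom_inj(1)[OF z(3)])
    show "push K M z' z'' u (push K M z z' u (row_inj K M z u i v)) = push K M z z'' u (row_inj K M z u i v)"
      if "i \<in> below u" "v \<in> carrier (obj M (i, z))" for i v
      using that z by (simp add: push_hom_inj(2) mor_closed mor_mor zz_le_refl)
  qed
  then show "push K M z' z'' u ((\<lambda>u\<in>above (a', b'). push K M z z' u (t u)) u) = push K M z z'' u (t u)"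
    using u' by simp
qed

lemma row_inj_path:
  assumes s: "s \<in> carrier (limit ezz_le M A)" and cd: "c \<le> d" "{c..d} \<subseteq> below u"
    and A: "{c..d} \<times> {z} \<subseteq> A"
  shows "row_inj K M z u d (s (d, z)) = row_inj K M z u c (s (c, z))"
proof -
  \<comment> \<open>Restricted to a segment of the row at height \<open>z\<close>, the family is a
    compatible family of the slice, to which \<open>colim_inj_path\<close> applies.\<close>
  define s' where "s' = (\<lambda>i\<in>{c..d}. s (i, z))"
  have inA: "(i, z) \<in> A" if "i \<in> {c..d}" for i
    using that A by auto
  have "s' i \<in> carrier (obj M (i, z))" if "i \<in> {c..d}" for i
    using that s inA[OF that] by (auto simp: s'_def limit_simps PiE_iff)
  moreover have "mor M (i, z) (j, z) (s' i) = s' j" if "i \<in> {c..d}" "j \<in> {c..d}" "zz_le i j" for i j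
    using that s inA[OF that(1)] inA[OF that(2)] by (auto simp: s'_def limit_simps)
  ultimately have "s' \<in> carrier (limit zz_le (slice M z) {c..d})"
    by (auto simp: limit_simps obj_slice mor_slice PiE_iff s'_def)
  then have "row_inj K M z u d (s' d) = row_inj K M z u c (s' c)"
    using slice.colim_inj_path[of s' z "{c..d}" "below u" "\<lambda>i. i" c d] cd by simp
  then show ?thesis
    using cd by (simp add: s'_def)
qed

text \<open>
  For \<open>u = (p, q)\<close>, any other index in \<open>[a, b] \<inter> [p, q]\<close> in place of
  \<open>max a p\<close> would give the same element.
\<close>

definition limit_to_block where
  "limit_to_block a b z s =
    (\<lambda>u\<in>above (b, a). row_inj K M z u (max a (fst u)) (s (max a (fst u), z)))"

text \<open>It retracts the overhang of \<open>below (a, b)\<close> onto \<open>[a, b]\<close>: an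
  odd \<open>a - 1\<close> goes to \<open>a\<close> and an odd \<open>b + 1\<close> to
  \<open>b\<close>, in both cases upwards in the zigzag order.\<close>

definition clamp :: "int \<Rightarrow> int \<Rightarrow> int \<Rightarrow> int" where
  "clamp a b i = max a (min b i)"

text \<open>For \<open>a \<le> b\<close> the least element of \<open>above (a, b)\<close> is
  \<open>(a, b)\<close>, so a family is determined by that component. The component lies in a row
  colimit at height \<open>z'\<close>, which is mapped into the colimit over the box along its top
  row.\<close>

definition block_to_colimit where
  "block_to_colimit a b z z' t = colim_desc (colimit K ezz_le M ({a..b} \<times> {z..z'})) (below (a, b))
    (\<lambda>i v. colim_inj K ezz_le M ({a..b} \<times> {z..z'}) (clamp a b i, z') (mor M (i, z') (clamp a b i, z') v))
    (t (a, b))"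

text \<open>Meant for sets \<open>below u\<close> with upper bound \<open>c\<close>. If
  \<open>c\<close> itself belongs to the set, the colimit is the space at \<open>c\<close>, and
  \<open>stalk\<close> is the inverse of the injection at \<open>c\<close>. The upper bound may be
  reached from more than one \<open>u\<close>, which is used to compare neighbouring stalks.\<close>

definition stalk where
  "stalk z u c = colim_desc (obj M (c, z)) (below u) (\<lambda>i. mor M (i, z) (c, z))"

text \<open>The diagonal points \<open>(c, c)\<close> with \<open>c\<close> in \<open>[a, b]\<close>
  lie in \<open>above (b, a)\<close>, and their components are vectors of the bottom row. A
  compatible family on the box is determined by its bottom row.\<close>

definition block_to_limit where
  "block_to_limit a b z z' t =
    (\<lambda>p\<in>{a..b} \<times> {z..z'}. mor M (fst p, z) p (stalk z (fst p, fst p) (fst p) (t (fst p, fst p))))"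

text \<open>Each point of the box lies below the top point of its column, so the colimit over the
  box maps to every row colimit at height \<open>z'\<close> whose index set contains
  \<open>[a, b]\<close>.\<close>

definition box_to_row where
  "box_to_row a b z z' u = colim_desc (obj (row K M z') u) ({a..b} \<times> {z..z'})
    (\<lambda>p v. row_inj K M z' u (fst p) (mor M p (fst p, z') v))"

definition colimit_to_block where
  "colimit_to_block a b z z' X = (\<lambda>u\<in>above (a, b). box_to_row a b z z' u X)"

section \<open>Linearity of the comparison maps and their values on generators\<close>

lemma limit_to_block_hom:
  assumes "a \<le> b" "z \<le> z'"
  shows "limit_to_block a b z \<in> module_hom K (limit ezz_le M ({a..b} \<times> {z..z'}))
    (obj (ext_block_ext K M) (b, a, z))"
  unfolding obj_block limit_to_block_def
proof (rule hom_into_limit)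
  let ?c = "\<lambda>u. max a (fst u)"
  have c: "(?c u, z) \<in> {a..b} \<times> {z..z'}" "?c u \<in> below u" if "u \<in> above (b, a)" for u
    using that assms by (cases u; auto simp: in_above in_below)+
  show "(\<lambda>s. row_inj K M z u (?c u) (s (?c u, z))) \<in>
      module_hom K (limit ezz_le M ({a..b} \<times> {z..z'})) (obj (row K M z) u)" if "u \<in> above (b, a)" for u
    using c[OF that] by (intro module_hom_comp[OF row_inj_hom limit_eval_hom])
  show "mor (row K M z) u u' (row_inj K M z u (?c u) (s (?c u, z))) = row_inj K M z u' (?c u') (s (?c u', z))"
    if u: "u \<in> above (b, a)" "u' \<in> above (b, a)" "opz_le u u'"
      and s: "s \<in> carrier (limit ezz_le M ({a..b} \<times> {z..z'}))" for u u' s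
  proof -
    have "s (?c u, z) \<in> carrier (obj M (?c u, z))"
      using s c(1)[OF u(1)] by (auto simp: limit_simps PiE_iff)
    then have "mor (row K M z) u u' (row_inj K M z u (?c u) (s (?c u, z))) = row_inj K M z u' (?c u) (s (?c u, z))"
      using u c by (intro row_mor_hom_inj(2))
    \<comment> \<open>Passing to the larger \<open>u'\<close> can only lower the first coordinate.
      The segment between the two chosen indices stays inside \<open>[a, b]\<close> and
      \<open>below u'\<close>, so \<open>row_inj_path\<close> connects them.\<close>
    also have "\<dots> = row_inj K M z u' (?c u') (s (?c u', z))"
      using u assms
      by (intro row_inj_path[OF s]) (cases u; cases u'; force simp: in_above in_below)+
    finally show ?thesis .
  qed
qed

lemma
  assumes "a \<le> b" "z \<le> z'"
  shows block_to_colimit_hom: "block_to_colimit a b z z' \<in>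
      module_hom K (obj (ext_block_ext K M) (a, b, z')) (colimit K ezz_le M ({a..b} \<times> {z..z'}))"
    and block_to_colimit_inj: "t (a, b) = row_inj K M z' (a, b) a v \<Longrightarrow> v \<in> carrier (obj M (a, z')) \<Longrightarrow>
      block_to_colimit a b z z' t = colim_inj K ezz_le M ({a..b} \<times> {z..z'}) (a, z') v"
proof -
  let ?B = "{a..b} \<times> {z..z'}"
  define h where
    "h i v = colim_inj K ezz_le M ?B (clamp a b i, z') (mor M (i, z') (clamp a b i, z') v)" for i v
  have le: "zz_le i (clamp a b i)" "(clamp a b i, z') \<in> ?B" if "i \<in> below (a, b)" for i
    using that assms by (auto simp: in_below zz_le_def clamp_def split: if_splits)
  have hom: "h i \<in> module_hom K (obj (slice M z') i) (colimit K ezz_le M ?B)" if "i \<in> below (a, b)" for i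
    unfolding h_def obj_slice
    using le[OF that] by (intro module_hom_comp[OF colim_inj_hom mor_hom]) simp
  have cocone: "h j (mor (slice M z') i j v) = h i v"
    if ij: "i \<in> below (a, b)" "j \<in> below (a, b)" "zz_le i j" and v: "v \<in> carrier (obj (slice M z') i)" for i j v
  proof (cases "i = j")
    case True
    then show ?thesis
      using v by (simp add: obj_slice mor_slice mor_refl)
  next
    case False
    then have "odd i" "j = i + 1 \<or> j = i - 1"
      using ij by (auto simp: zz_le_def)
    \<comment> \<open>The sink \<open>j\<close> is even and hence lies in \<open>[a, b]\<close>. The
      source \<open>i\<close> either lies there too or overhangs, and then its only neighbour in the
      set is \<open>j\<close>, to which it is clamped.\<close>
    then have cj: "clamp a b j = j" and ci: "clamp a b i = i \<or> clamp a b i = j"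
      using ij assms by (auto simp: in_below clamp_def)
    have v: "v \<in> carrier (obj M (i, z'))" and ijz: "ezz_le (i, z') (j, z')"
      using v ij by (auto simp: obj_slice)
    have "h j (mor (slice M z') i j v) = colim_inj K ezz_le M ?B (j, z') (mor M (i, z') (j, z') v)"
      using mor_closed[OF ijz v] by (simp add: h_def cj mor_slice mor_refl)
    also have "\<dots> = h i v"
      using ci
    proof
      assume ci: "clamp a b i = i"
      have "colim_inj K ezz_le M ?B (j, z') (mor M (i, z') (j, z') v) = colim_inj K ezz_le M ?B (i, z') v"
        using le[OF ij(1)] le[OF ij(2)] ci cj ijz v by (intro colim_inj_mor) auto
      then show ?thesis
        using v by (simp add: h_def ci mor_refl)
    qed (simp add: h_def)
    finally show ?thesis .
  qed
  note desc = slice.colim_desc_hom[OF finite_below vectorspace_colimit hom cocone]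
    slice.colim_desc_inj[OF finite_below vectorspace_colimit hom cocone]
  have ab: "(a, b) \<in> above (a, b)" "a \<in> below (a, b)"
    using assms by (auto simp: in_above in_below)
  have eval: "(\<lambda>t. t (a, b)) \<in> module_hom K (obj (ext_block_ext K M) (a, b, z')) (obj (row K M z') (a, b))"
    unfolding obj_block using ab(1) by (rule limit_eval_hom)
  show "block_to_colimit a b z z' \<in>
      module_hom K (obj (ext_block_ext K M) (a, b, z')) (colimit K ezz_le M ?B)"
    unfolding block_to_colimit_def
    using module_hom_comp[OF desc(1)[folded obj_row] eval] unfolding h_def .
  show "block_to_colimit a b z z' t = colim_inj K ezz_le M ?B (a, z') v"
    if "t (a, b) = row_inj K M z' (a, b) a v" "v \<in> carrier (obj M (a, z'))"
  proof -
    have "colim_desc (colimit K ezz_le M ?B) (below (a, b)) h (row_inj K M z' (a, b) a v) = h a v"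
      by (rule desc(2)[unfolded obj_slice]) (assumption | rule that ab)+
    then show ?thesis
      using that assms unfolding block_to_colimit_def h_def by (simp add: clamp_def mor_refl)
  qed
qed

lemma
  assumes u: "\<And>i. i \<in> below u \<Longrightarrow> zz_le i c"
  shows stalk_hom: "stalk z u c \<in> module_hom K (obj (row K M z) u) (obj M (c, z))"
    and stalk_inj: "i \<in> below u \<Longrightarrow> v \<in> carrier (obj M (i, z)) \<Longrightarrow>
      stalk z u c (row_inj K M z u i v) = mor M (i, z) (c, z) v"
proof -
  have hom: "mor M (i, z) (c, z) \<in> module_hom K (obj (slice M z) i) (obj M (c, z))" if "i \<in> below u" for i
    unfolding obj_slice using u[OF that] by (intro mor_hom) simp
  have cocone: "mor M (j, z) (c, z) (mor (slice M z) i j v) = mor M (i, z) (c, z) v"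
    if "i \<in> below u" "j \<in> below u" "zz_le i j" "v \<in> carrier (obj (slice M z) i)" for i j v
    using that u by (simp add: obj_slice mor_slice mor_mor)
  note desc = slice.colim_desc_hom[OF finite_below obj.vectorspace_axioms hom cocone]
    slice.colim_desc_inj[OF finite_below obj.vectorspace_axioms hom cocone]
  show "stalk z u c \<in> module_hom K (obj (row K M z) u) (obj M (c, z))"
    unfolding stalk_def obj_row by (rule desc(1))
  show "stalk z u c (row_inj K M z u i v) = mor M (i, z) (c, z) v"
    if "i \<in> below u" "v \<in> carrier (obj M (i, z))"
    unfolding stalk_def by (rule desc(2)[unfolded obj_slice]) (assumption | rule that)+
qed

lemma stalk_closed:
  assumes "\<And>i. i \<in> below u \<Longrightarrow> zz_le i c" "X \<in> carrier (obj (row K M z) u)"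
  shows "stalk z u c X \<in> carrier (obj M (c, z))"
  using module_hom_closed[OF stalk_hom] assms by (auto simp: Pi_iff)

lemma stalk_row_mor:
  assumes u: "opz_le u u'" and c: "\<And>i. i \<in> below u' \<Longrightarrow> zz_le i c"
    and X: "X \<in> carrier (obj (row K M z) u)"
  shows "stalk z u' c (mor (row K M z) u u' X) = stalk z u c X"
proof (rule row_hom_eqI[OF obj.vectorspace_axioms _ _ _ X])
  have c': "zz_le i c" if "i \<in> below u" for i
    using below_mono[OF u] c that by blast
  show "(\<lambda>X. stalk z u' c (mor (row K M z) u u' X)) \<in> module_hom K (obj (row K M z) u) (obj M (c, z))"
    by (intro module_hom_comp[OF stalk_hom row_mor_hom_inj(1)] c u)
  show "stalk z u c \<in> module_hom K (obj (row K M z) u) (obj M (c, z))"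
    by (intro stalk_hom c')
  show "stalk z u' c (mor (row K M z) u u' (row_inj K M z u i v)) = stalk z u c (row_inj K M z u i v)"
    if i: "i \<in> below u" "v \<in> carrier (obj M (i, z))" for i v
  proof -
    have "i \<in> below u'"
      using below_mono[OF u] i by blast
    then show ?thesis
      using i by (simp only: row_mor_hom_inj(2)[OF u i] stalk_inj[OF c] stalk_inj[OF c'])
  qed
qed

lemma mor_stalk:
  assumes c: "\<And>i. i \<in> below u \<Longrightarrow> zz_le i c" and d: "\<And>i. i \<in> below u \<Longrightarrow> zz_le i d" and cd: "zz_le c d"
    and X: "X \<in> carrier (obj (row K M z) u)"
  shows "mor M (c, z) (d, z) (stalk z u c X) = stalk z u d X"
proof (rule row_hom_eqI[OF obj.vectorspace_axioms _ _ _ X])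
  have le: "ezz_le (c, z) (d, z)"
    using cd by simp
  show "(\<lambda>X. mor M (c, z) (d, z) (stalk z u c X)) \<in> module_hom K (obj (row K M z) u) (obj M (d, z))"
    by (intro module_hom_comp[OF mor_hom[OF le] stalk_hom] c)
  show "stalk z u d \<in> module_hom K (obj (row K M z) u) (obj M (d, z))"
    by (intro stalk_hom d)
  show "mor M (c, z) (d, z) (stalk z u c (row_inj K M z u i v)) = stalk z u d (row_inj K M z u i v)"
    if i: "i \<in> below u" "v \<in> carrier (obj M (i, z))" for i v
    using i c[OF i(1)] le by (simp add: stalk_inj[OF c] stalk_inj[OF d] mor_mor)
qed

lemma below_diag: "i \<in> below (c, c) \<Longrightarrow> zz_le i c"
  by (auto simp: in_below zz_le_def split: if_splits)

text \<open>The interval between a source \<open>c\<close> and a neighbouring sink \<open>c'\<close>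
  overhangs only at the even end. It therefore consists of \<open>c'\<close> and its two sources,
  which is the down-set of \<open>c'\<close>.\<close>

lemma below_edge: "odd c \<Longrightarrow> c' = c + 1 \<or> c' = c - 1 \<Longrightarrow> i \<in> below (min c c', max c c') \<Longrightarrow> zz_le i c'"
  by (auto simp: in_below zz_le_def split: if_splits) presburger+

lemma block_to_limit_hom:
  assumes "a \<le> b" "z \<le> z'"
  shows "block_to_limit a b z z' \<in> module_hom K (obj (ext_block_ext K M) (b, a, z))
    (limit ezz_le M ({a..b} \<times> {z..z'}))"
  unfolding block_to_limit_def
proof (rule hom_into_limit)
  let ?E = "obj (ext_block_ext K M) (b, a, z)"
  let ?st = "\<lambda>c t. stalk z (c, c) c (t (c, c))"
  have diag: "(c, c) \<in> above (b, a)" if "c \<in> {a..b}" for c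
    using that by (simp add: in_above)
  have st: "?st c \<in> module_hom K ?E (obj M (c, z))" if "c \<in> {a..b}" for c
    using module_hom_comp[OF stalk_hom limit_eval_hom] below_diag diag[OF that] unfolding obj_block by blast
  have le: "ezz_le (fst p, z) p" if "p \<in> {a..b} \<times> {z..z'}" for p
    using that by (cases p) (auto simp: zz_le_refl)
  show "(\<lambda>t. mor M (fst p, z) p (?st (fst p) t)) \<in> module_hom K ?E (obj M p)"
    if "p \<in> {a..b} \<times> {z..z'}" for p
    using that by (intro module_hom_comp[OF mor_hom st] le) auto
  fix p q t
  assume p: "p \<in> {a..b} \<times> {z..z'}" and q: "q \<in> {a..b} \<times> {z..z'}" and pq: "ezz_le p q" and t: "t \<in> carrier ?E"
  obtain c w c' w' where pw: "p = (c, w)" and qw: "q = (c', w')"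
    by (cases p; cases q)
  have cc: "c \<in> {a..b}" "c' \<in> {a..b}" "z \<le> w" "zz_le c c'" "w \<le> w'"
    using p q pq by (auto simp: pw qw)
  have x: "?st c t \<in> carrier (obj M (c, z))"
    using module_hom_closed[OF st[OF cc(1)]] t by (rule funcset_mem)
  have eq: "mor M (c, z) (c', z) (?st c t) = ?st c' t"
  proof (cases "c = c'")
    case True
    then show ?thesis
      using x by (simp add: mor_refl)
  next
    case False
    then have odd: "odd c" "c' = c + 1 \<or> c' = c - 1"
      using cc by (auto simp: zz_le_def)
    \<comment> \<open>This is the join of \<open>(c, c)\<close> and \<open>(c', c')\<close>. The
      components of \<open>t\<close> at both points have the same image at \<open>u\<close>, and all
      of \<open>below u\<close> maps to the space at \<open>c'\<close>, so the two stalks can be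
      compared there.\<close>
    define u where "u = (min c c', max c c')"
    have u: "u \<in> above (b, a)" and le: "opz_le (c, c) u" "opz_le (c', c') u"
      using cc by (auto simp: u_def in_above)
    have below_u: "zz_le i c'" if "i \<in> below u" for i
      using below_edge[OF odd] that by (simp add: u_def)
    have "mor M (c, z) (c', z) (?st c t) = stalk z (c, c) c' (t (c, c))"
      using below_mono[OF le(1)]
      by (intro mor_stalk[OF _ _ cc(4) block_closed[OF t diag[OF cc(1)]]])
        (blast intro: below_diag below_u)+
    also have "\<dots> = stalk z u c' (mor (row K M z) (c, c) u (t (c, c)))"
      by (rule stalk_row_mor[OF le(1) below_u block_closed[OF t diag[OF cc(1)]], symmetric])
    also have "\<dots> = stalk z u c' (mor (row K M z) (c', c') u (t (c', c')))"
      using block_compat[OF t diag[OF cc(1)] u le(1)] block_compat[OF t diag[OF cc(2)] u le(2)] by simp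
    also have "\<dots> = ?st c' t"
      by (rule stalk_row_mor[OF le(2) below_u block_closed[OF t diag[OF cc(2)]]])
    finally show ?thesis .
  qed
  \<comment> \<open>Functoriality replaces both paths by paths that first run along the bottom row,
    where \<open>eq\<close> gives compatibility.\<close>
  have "mor M p q (mor M (c, z) p (?st c t)) = mor M (c, z) q (?st c t)"
    using cc x by (intro mor_mor) (auto simp: pw qw zz_le_refl)
  also have "\<dots> = mor M (c', z) q (mor M (c, z) (c', z) (?st c t))"
    using cc x by (intro mor_mor[symmetric]) (auto simp: qw zz_le_refl)
  finally show "mor M p q (mor M (fst p, z) p (?st (fst p) t)) = mor M (fst q, z) q (?st (fst q) t)"
    by (simp add: pw qw eq)
qed

lemma
  assumes u: "{a..b} \<subseteq> below u"
  shows box_to_row_hom: "box_to_row a b z z' u \<in>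
      module_hom K (colimit K ezz_le M ({a..b} \<times> {z..z'})) (obj (row K M z') u)"
    and box_to_row_inj: "p \<in> {a..b} \<times> {z..z'} \<Longrightarrow> v \<in> carrier (obj M p) \<Longrightarrow>
      box_to_row a b z z' u (colim_inj K ezz_le M ({a..b} \<times> {z..z'}) p v) =
        row_inj K M z' u (fst p) (mor M p (fst p, z') v)"
proof -
  define h where "h p v = row_inj K M z' u (fst p) (mor M p (fst p, z') v)" for p v
  have le: "ezz_le p (fst p, z')" if "p \<in> {a..b} \<times> {z..z'}" for p
    using that by (cases p) (auto simp: zz_le_refl)
  have fin: "finite ({a..b} \<times> {z..z'})"
    by simp
  have hom: "h p \<in> module_hom K (obj M p) (obj (row K M z') u)" if "p \<in> {a..b} \<times> {z..z'}" for p
    unfolding h_def using le[OF that] by (intro module_hom_comp[OF row_inj_hom mor_hom])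
  have cocone: "h q (mor M p q v) = h p v"
    if pq: "p \<in> {a..b} \<times> {z..z'}" "q \<in> {a..b} \<times> {z..z'}" "ezz_le p q" and v: "v \<in> carrier (obj M p)" for p q v
  proof -
    have zz: "zz_le (fst p) (fst q)" "fst p \<in> below u" "fst q \<in> below u"
      using pq u by (auto simp: rel_prod_conv)
    then have le': "ezz_le (fst p, z') (fst q, z')"
      by simp
    \<comment> \<open>Both sides are the structure map from \<open>p\<close> to
      \<open>(fst q, z')\<close>, once through \<open>q\<close> and once through the top of the
      column of \<open>p\<close>.\<close>
    have "mor M q (fst q, z') (mor M p q v) = mor M (fst p, z') (fst q, z') (mor M p (fst p, z') v)"
      using mor_mor[OF pq(3) le[OF pq(2)] v] mor_mor[OF le[OF pq(1)] le' v] by simp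
    then show ?thesis
      unfolding h_def using row_inj_mor[OF zz(2,3,1) mor_closed[OF le[OF pq(1)] v]] by simp
  qed
  show "box_to_row a b z z' u \<in>
      module_hom K (colimit K ezz_le M ({a..b} \<times> {z..z'})) (obj (row K M z') u)"
    unfolding box_to_row_def using colim_desc_hom[OF fin vectorspace_row hom cocone] unfolding h_def .
  show "box_to_row a b z z' u (colim_inj K ezz_le M ({a..b} \<times> {z..z'}) p v) =
      row_inj K M z' u (fst p) (mor M p (fst p, z') v)"
    if "p \<in> {a..b} \<times> {z..z'}" "v \<in> carrier (obj M p)"
  proof -
    have "colim_desc (obj (row K M z') u) ({a..b} \<times> {z..z'}) h
        (colim_inj K ezz_le M ({a..b} \<times> {z..z'}) p v) = h p v"
      by (rule colim_desc_inj[OF fin vectorspace_row hom cocone]) (assumption | rule that)+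
    then show ?thesis
      unfolding box_to_row_def h_def .
  qed
qed

lemma subset_below_above: "u \<in> above (a, b) \<Longrightarrow> {a..b} \<subseteq> below u"
  by (cases u) (auto simp: in_above in_below)

lemma colimit_to_block_hom:
  "colimit_to_block a b z z' \<in> module_hom K (colimit K ezz_le M ({a..b} \<times> {z..z'}))
    (obj (ext_block_ext K M) (a, b, z'))"
  unfolding obj_block colimit_to_block_def
proof (rule hom_into_limit)
  let ?B = "{a..b} \<times> {z..z'}"
  show hom: "box_to_row a b z z' u \<in> module_hom K (colimit K ezz_le M ?B) (obj (row K M z') u)"
    if "u \<in> above (a, b)" for u
    using subset_below_above[OF that] by (rule box_to_row_hom)
  fix u u' X
  assume u: "u \<in> above (a, b)" "u' \<in> above (a, b)" "opz_le u u'" and X: "X \<in> carrier (colimit K ezz_le M ?B)"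
  show "mor (row K M z') u u' (box_to_row a b z z' u X) = box_to_row a b z z' u' X"
  proof (rule colimit_hom_eqI[OF vectorspace_row _ _ _ X])
    show "(\<lambda>X. mor (row K M z') u u' (box_to_row a b z z' u X)) \<in>
        module_hom K (colimit K ezz_le M ?B) (obj (row K M z') u')"
      by (rule module_hom_comp[OF row_mor_hom_inj(1)[OF u(3)] hom[OF u(1)]])
    show "box_to_row a b z z' u' \<in> module_hom K (colimit K ezz_le M ?B) (obj (row K M z') u')"
      by (rule hom[OF u(2)])
    show "mor (row K M z') u u' (box_to_row a b z z' u (colim_inj K ezz_le M ?B p v)) =
        box_to_row a b z z' u' (colim_inj K ezz_le M ?B p v)" if p: "p \<in> ?B" "v \<in> carrier (obj M p)" for p v
    proof -
      have "ezz_le p (fst p, z')" "fst p \<in> below u"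
        using p subset_below_above[OF u(1)] by (auto simp: zz_le_refl)
      then show ?thesis
        unfolding box_to_row_inj[OF subset_below_above[OF u(1)] p]
          box_to_row_inj[OF subset_below_above[OF u(2)] p]
        using p by (intro row_mor_hom_inj(2)[OF u(3)] mor_closed)
    qed
  qed
qed

section \<open>The rank map of a box and the structure map of the block extension\<close>

text \<open>\<open>lim_to_colim\<close> uses an arbitrary point of the box. From there one goes down
  the column to the bottom row and then along that row to the corner \<open>(a, z)\<close>; neither
  move changes the element of the colimit.\<close>

lemma lim_to_colim_box:
  assumes "a \<le> b" "z \<le> z'" and s: "s \<in> carrier (limit ezz_le M ({a..b} \<times> {z..z'}))"
  shows "lim_to_colim K ezz_le M ({a..b} \<times> {z..z'}) s =
    colim_inj K ezz_le M ({a..b} \<times> {z..z'}) (a, z) (s (a, z))"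
proof -
  let ?B = "{a..b} \<times> {z..z'}"
  have "(SOME p. p \<in> ?B) \<in> ?B"
    using assms by (intro someI[of "\<lambda>p. p \<in> ?B" "(a, z)"]) auto
  then obtain c w where cw: "(SOME p. p \<in> ?B) = (c, w)" "(c, w) \<in> ?B"
    by (metis surj_pair)
  have "colim_inj K ezz_le M ?B (c, w) (s (c, w)) = colim_inj K ezz_le M ?B (c, z) (s (c, z))"
    using cw by (intro colim_inj_compat[OF s]) (auto simp: zz_le_refl)
  also have "\<dots> = colim_inj K ezz_le M ?B (a, z) (s (a, z))"
  proof (rule colim_inj_path[OF s subset_refl, of "\<lambda>i. (i, z)"])
    show "(\<lambda>i. (i, z)) ` {a..c} \<subseteq> ?B"
      using cw by auto
  qed (use cw in auto)
  finally show ?thesis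
    by (simp add: lim_to_colim_def cw)
qed

text \<open>First factorisation: the rank map through the structure map.
  \<open>block_to_colimit\<close> looks only at the component \<open>(a, b)\<close>, where
  \<open>limit_to_block\<close> uses the index \<open>max a a = a\<close>; the structure map then
  carries \<open>s (a, z)\<close> up to \<open>s (a, z')\<close>.\<close>

lemma lim_to_colim_eq_block:
  assumes ab: "a \<le> b" "z \<le> z'" and s: "s \<in> carrier (limit ezz_le M ({a..b} \<times> {z..z'}))"
  shows "block_to_colimit a b z z' (mor (ext_block_ext K M) (b, a, z) (a, b, z') (limit_to_block a b z s)) =
    lim_to_colim K ezz_le M ({a..b} \<times> {z..z'}) s"
proof -
  let ?B = "{a..b} \<times> {z..z'}"
  have in_B: "(a, z) \<in> ?B" "(a, z') \<in> ?B" and le: "ezz_le (a, z) (a, z')"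
    using ab by (auto simp: zz_le_refl)
  then have sa: "s (a, z) \<in> carrier (obj M (a, z))" "mor M (a, z) (a, z') (s (a, z)) = s (a, z')"
    "s (a, z') \<in> carrier (obj M (a, z'))"
    using s unfolding limit_simps by (auto simp: PiE_iff)
  have u: "(a, b) \<in> above (a, b)" "(a, b) \<in> above (b, a)" "a \<in> below (a, b)"
    using ab by (auto simp: in_above in_below)
  have "mor (ext_block_ext K M) (b, a, z) (a, b, z') (limit_to_block a b z s) (a, b) =
      row_inj K M z' (a, b) a (s (a, z'))"
    using u sa by (simp add: mor_block limit_to_block_def push_hom_inj(2)[OF ab(2)])
  then have "block_to_colimit a b z z' (mor (ext_block_ext K M) (b, a, z) (a, b, z') (limit_to_block a b z s)) =
      colim_inj K ezz_le M ?B (a, z') (s (a, z'))"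
    using sa(3) by (rule block_to_colimit_inj[OF ab])
  also have "\<dots> = colim_inj K ezz_le M ?B (a, z) (s (a, z))"
    by (rule colim_inj_compat[OF s in_B subset_refl le])
  finally show ?thesis
    using lim_to_colim_box[OF ab s] by simp
qed

text \<open>Opposite factorisation: the structure map through the rank map. Every component that
  survives in the target is the image of the component at \<open>(a, a)\<close>, which amounts to a
  vector at the corner \<open>(a, z)\<close> of the box.\<close>

lemma mor_block_eq_lim_to_colim:
  assumes ab: "a \<le> b" "z \<le> z'" and t: "t \<in> carrier (obj (ext_block_ext K M) (b, a, z))"
  shows "mor (ext_block_ext K M) (b, a, z) (a, b, z') t =
    colimit_to_block a b z z' (lim_to_colim K ezz_le M ({a..b} \<times> {z..z'}) (block_to_limit a b z z' t))"
proof -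
  let ?B = "{a..b} \<times> {z..z'}"
  have aa: "(a, a) \<in> above (b, a)" and in_B: "(a, z) \<in> ?B" and le: "ezz_le (a, z) (a, z')"
    using ab by (auto simp: in_above zz_le_refl)
  have ta: "t (a, a) \<in> carrier (obj (row K M z) (a, a))"
    by (rule block_closed[OF t aa])
  define y where "y = stalk z (a, a) a (t (a, a))"
  have y: "y \<in> carrier (obj M (a, z))"
    unfolding y_def by (rule stalk_closed[OF below_diag ta])
  have s: "block_to_limit a b z z' t \<in> carrier (limit ezz_le M ?B)"
    using module_hom_closed[OF block_to_limit_hom[OF ab]] t by (rule funcset_mem)
  have "block_to_limit a b z z' t (a, z) = y"
    using in_B y by (simp add: block_to_limit_def mor_refl y_def)
  then have l2c: "lim_to_colim K ezz_le M ?B (block_to_limit a b z z' t) = colim_inj K ezz_le M ?B (a, z) y"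
    using lim_to_colim_box[OF ab s] by simp
  show ?thesis
    unfolding l2c mor_block colimit_to_block_def
  proof (rule restrict_ext)
    fix u assume u: "u \<in> above (a, b)"
    have u': "u \<in> above (b, a)" "opz_le (a, a) u" "a \<in> below u"
      using u ab by (cases u; auto simp: in_above in_below)+
    \<comment> \<open>Here \<open>a \<le> b\<close> is used: each \<open>u\<close> in
      \<open>above (a, b)\<close> satisfies \<open>opz_le (a, a) u\<close>, and
      \<open>(a, a)\<close> lies in \<open>above (b, a)\<close>.\<close>
    have "push K M z z' u (t u) = push K M z z' u (mor (row K M z) (a, a) u (t (a, a)))"
      using block_compat[OF t aa u'(1,2)] by simp
    also have "\<dots> = row_inj K M z' u a (mor M (a, z) (a, z') (stalk z (a, a) a (t (a, a))))"
    proof (rule row_hom_eqI[OF vectorspace_row _ _ _ ta])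
      show "(\<lambda>X. push K M z z' u (mor (row K M z) (a, a) u X)) \<in>
          module_hom K (obj (row K M z) (a, a)) (obj (row K M z') u)"
        by (rule module_hom_comp[OF push_hom_inj(1)[OF ab(2)] row_mor_hom_inj(1)[OF u'(2)]])
      show "(\<lambda>X. row_inj K M z' u a (mor M (a, z) (a, z') (stalk z (a, a) a X))) \<in>
          module_hom K (obj (row K M z) (a, a)) (obj (row K M z') u)"
        by (intro module_hom_comp[OF row_inj_hom module_hom_comp[OF mor_hom[OF le] stalk_hom]] below_diag)
      show "push K M z z' u (mor (row K M z) (a, a) u (row_inj K M z (a, a) i v)) =
          row_inj K M z' u a (mor M (a, z) (a, z') (stalk z (a, a) a (row_inj K M z (a, a) i v)))"
        if i: "i \<in> below (a, a)" "v \<in> carrier (obj M (i, z))" for i v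
      proof -
        have iu: "i \<in> below u"
          using below_mono[OF u'(2)] i by blast
        note ia = below_diag[OF i(1)]
        have le': "ezz_le (i, z) (i, z')" "ezz_le (i, z) (a, z)" "ezz_le (i, z') (a, z')"
          using ia ab by (auto simp: zz_le_refl)
        have "mor M (a, z) (a, z') (stalk z (a, a) a (row_inj K M z (a, a) i v)) =
            mor M (i, z') (a, z') (mor M (i, z) (i, z') v)"
          using stalk_inj[OF below_diag i] mor_mor[OF le'(2) le i(2)] mor_mor[OF le'(1,3) i(2)] by simp
        then show ?thesis
          using row_inj_mor[OF iu u'(3) ia mor_closed[OF le'(1) i(2)]]
          by (simp add: row_mor_hom_inj(2)[OF u'(2) i] push_hom_inj(2)[OF ab(2) iu i(2)])
      qed
    qed
    also have "\<dots> = box_to_row a b z z' u (colim_inj K ezz_le M ?B (a, z) y)"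
      using box_to_row_inj[OF subset_below_above[OF u] in_B y] by (simp add: y_def)
    finally show "push K M z z' u (t u) = box_to_row a b z z' u (colim_inj K ezz_le M ?B (a, z) y)" .
  qed
qed

end

section \<open>Stability of the landscapes\<close>

lemma square_eq: "square x r = {fst x - int r..fst x + int r} \<times> {snd x - int r..snd x + int r}"
  by (auto simp: square_def)

text \<open>The structure map of \<open>F\<close> over the large box starts with the shift by
  \<open>v + v\<close>, which is \<open>\<nu>\<close> after \<open>\<eta>\<close>. Naturality of
  \<open>\<nu>\<close> then replaces the rest of it by the structure map of \<open>G\<close> over
  the small box, and the two factorisations turn this into a statement on rank maps.\<close>

lemma gen_rank_le_of_interleaved:
  assumes M: "ezz_diagram K M" and N: "ezz_diagram K N"
    and inter: "interleaved K (- int \<epsilon>, int \<epsilon>, int \<epsilon>) (ext_block_ext K M) (ext_block_ext K N)"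
    and r: "\<epsilon> \<le> r"
  shows "gen_rank K ezz_le M (square x r) \<le> gen_rank K ezz_le N (square x (r - \<epsilon>))"
proof -
  interpret M: ezz_diagram K M by (rule M)
  interpret N: ezz_diagram K N by (rule N)
  define v where "v = (- int \<epsilon>, int \<epsilon>, int \<epsilon>)"
  define F where "F = ext_block_ext K M"
  define G where "G = ext_block_ext K N"
  obtain \<eta> \<nu> where \<eta>: "nat_trans K opzz_le F (shift v G) \<eta>" and \<nu>: "nat_trans K opzz_le G (shift v F) \<nu>"
    and \<nu>\<eta>: "\<And>p t. t \<in> carrier (obj F p) \<Longrightarrow> \<nu> (p + v) (\<eta> p t) = mor F p (p + (v + v)) t"
    using inter unfolding interleaved_def v_def F_def G_def by blast
  define a b z z' where "a = fst x - int r" and "b = fst x + int r"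
    and "z = snd x - int r" and "z' = snd x + int r"
  define c d w w' where "c = a + int \<epsilon>" and "d = b - int \<epsilon>" and "w = z + int \<epsilon>" and "w' = z' - int \<epsilon>"
  have le: "a \<le> b" "z \<le> z'" "c \<le> d" "w \<le> w'"
    using r by (auto simp: a_def b_def c_def d_def z_def z'_def w_def w'_def)
  have squares: "square x r = {a..b} \<times> {z..z'}" "square x (r - \<epsilon>) = {c..d} \<times> {w..w'}"
    using r by (auto simp: square_eq a_def b_def c_def d_def z_def z'_def w_def w'_def of_nat_diff)
  \<comment> \<open>The shift \<open>v\<close> takes the start \<open>(b, a, z)\<close> of the large
    box to the start \<open>(d, c, w)\<close> of the small one, and the end
    \<open>(c, d, w')\<close> of the small box to the end \<open>(a, b, z')\<close> of the large
    one. The assumption \<open>\<epsilon> \<le> r\<close> is what places \<open>m\<close> below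
    \<open>(a, b, z')\<close>.\<close>
  define m where "m = (b - 2 * int \<epsilon>, a + 2 * int \<epsilon>, z + 2 * int \<epsilon>)"
  have pts: "(b, a, z) + v = (d, c, w)" "(c, d, w') + v = (a, b, z')"
      "(b, a, z) + (v + v) = m" "(d, c, w) + v = m"
    and orders: "opzz_le (b, a, z) m" "opzz_le m (a, b, z')" "opzz_le (d, c, w) (c, d, w')"
    using r by (auto simp: v_def m_def a_def b_def c_def d_def z_def z'_def w_def w'_def)
  let ?B = "{a..b} \<times> {z..z'}" and ?C = "{c..d} \<times> {w..w'}"
  \<comment> \<open>The maps \<open>f\<close> and \<open>g\<close> lead from the limit over the
    large box for \<open>M\<close> to the limit over the small box for \<open>N\<close>, and from
    the colimit for \<open>N\<close> back to that for \<open>M\<close>.\<close>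
  define f where "f s = N.block_to_limit c d w w' (\<eta> (b, a, z) (M.limit_to_block a b z s))" for s
  define g where "g X = M.block_to_colimit a b z z' (\<nu> (c, d, w') (N.colimit_to_block c d w w' X))" for X
  have \<eta>_hom: "\<eta> (b, a, z) \<in> module_hom K (obj F (b, a, z)) (obj G (d, c, w))"
    using \<eta> unfolding nat_trans_def by (simp add: shift_def flip: pts(1))
  have \<nu>_hom: "\<nu> (c, d, w') \<in> module_hom K (obj G (c, d, w')) (obj F (a, b, z'))"
    using \<nu> unfolding nat_trans_def by (simp add: shift_def flip: pts(2))
  have \<nu>_nat: "\<nu> (c, d, w') (mor G (d, c, w) (c, d, w') t) = mor F m (a, b, z') (\<nu> (d, c, w) t)"
    if "t \<in> carrier (obj G (d, c, w))" for t
    using \<nu> that orders(3) unfolding nat_trans_def by (simp add: shift_def pts(4) flip: pts(2))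
  have f: "f \<in> module_hom K (limit ezz_le M ?B) (limit ezz_le N ?C)"
    unfolding f_def
    by (rule module_hom_comp[OF N.block_to_limit_hom[OF le(3,4)]
      module_hom_comp[OF \<eta>_hom[unfolded F_def G_def] M.limit_to_block_hom[OF le(1,2)]]])
  have g: "g \<in> module_hom K (colimit K ezz_le N ?C) (colimit K ezz_le M ?B)"
    unfolding g_def
    by (rule module_hom_comp[OF M.block_to_colimit_hom[OF le(1,2)]
      module_hom_comp[OF \<nu>_hom[unfolded F_def G_def] N.colimit_to_block_hom]])
  have nonempty: "?B \<noteq> {}" "?C \<noteq> {}"
    using le by auto
  have factor: "lim_to_colim K ezz_le M ?B s = g (lim_to_colim K ezz_le N ?C (f s))"
    if s: "s \<in> carrier (limit ezz_le M ?B)" for s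
  proof -
    define t where "t = M.limit_to_block a b z s"
    have t: "t \<in> carrier (obj F (b, a, z))"
      unfolding t_def F_def using module_hom_closed[OF M.limit_to_block_hom[OF le(1,2)]] s by (rule funcset_mem)
    have \<eta>t: "\<eta> (b, a, z) t \<in> carrier (obj G (d, c, w))"
      using module_hom_closed[OF \<eta>_hom] t by (rule funcset_mem)
    have "mor F (b, a, z) (a, b, z') t = mor F m (a, b, z') (mor F (b, a, z) m t)"
      using M.block_mor_mor[OF t[unfolded F_def]] orders(1,2) unfolding F_def m_def by simp
    also have "\<dots> = mor F m (a, b, z') (\<nu> (d, c, w) (\<eta> (b, a, z) t))"
      using \<nu>\<eta>[OF t] by (simp only: pts)
    also have "\<dots> = \<nu> (c, d, w') (mor G (d, c, w) (c, d, w') (\<eta> (b, a, z) t))"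
      using \<nu>_nat[OF \<eta>t] by simp
    also have "\<dots> = \<nu> (c, d, w') (N.colimit_to_block c d w w' (lim_to_colim K ezz_le N ?C (f s)))"
      using N.mor_block_eq_lim_to_colim[OF le(3,4) \<eta>t[unfolded G_def]] by (simp add: f_def t_def G_def)
    finally show ?thesis
      using M.lim_to_colim_eq_block[OF le(1,2) s] by (simp add: g_def t_def F_def)
  qed
  show ?thesis
    unfolding gen_rank_def squares
    by (rule map_rank_factor_le[OF N.vectorspace_limit N.vectorspace_colimit M.vectorspace_limit
      M.vectorspace_colimit N.lim_to_colim_hom[OF nonempty(2)] f g
      N.fin_dim_lim_to_colim[OF nonempty(2)]]) (rule factor)
qed

lemma interleaved_sym: "interleaved K v F G \<Longrightarrow> interleaved K v G F"
  unfolding interleaved_def by blast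

text \<open>
  If one of \<open>A\<close> and \<open>B\<close> is infinite, then so is the other one, and \<open>Sup\<close> has the same
  unspecified value for all infinite sets of natural numbers.
\<close>

lemma Sup_nat_shift_le:
  fixes A B :: "nat set"
  assumes AB: "\<And>r. r \<in> A \<Longrightarrow> \<epsilon> \<le> r \<Longrightarrow> r - \<epsilon> \<in> B" and BA: "\<And>r. r \<in> B \<Longrightarrow> \<epsilon> \<le> r \<Longrightarrow> r - \<epsilon> \<in> A"
  shows "\<bar>real (Sup A) - real (Sup B)\<bar> \<le> real \<epsilon>"
proof -
  \<comment> \<open>Apart from finitely many elements, \<open>X\<close> is contained in
    \<open>Y\<close> shifted by \<open>\<epsilon>\<close>.\<close>
  have inf: "infinite Y" if XY: "\<And>r. r \<in> X \<Longrightarrow> \<epsilon> \<le> r \<Longrightarrow> r - \<epsilon> \<in> Y" and X: "infinite X" for X Y :: "nat set"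
  proof
    assume "finite Y"
    moreover have "X \<subseteq> {..<\<epsilon>} \<union> (\<lambda>r. r + \<epsilon>) ` Y"
    proof
      fix r assume "r \<in> X"
      then show "r \<in> {..<\<epsilon>} \<union> (\<lambda>r. r + \<epsilon>) ` Y"
        using XY[of r] by (cases "r < \<epsilon>") (auto intro!: image_eqI[of _ _ "r - \<epsilon>"])
    qed
    ultimately show False
      using X finite_subset by blast
  qed
  have fin: "Sup X \<le> Sup Y + \<epsilon>" if XY: "\<And>r. r \<in> X \<Longrightarrow> \<epsilon> \<le> r \<Longrightarrow> r - \<epsilon> \<in> Y" and Y: "finite Y" for X Y :: "nat set"
  proof (cases "X = {}")
    case False
    have "r \<le> Sup Y + \<epsilon>" if "r \<in> X" for r
      using cSup_upper[of "r - \<epsilon>" Y] XY[OF that] Y by (cases "\<epsilon> \<le> r") (auto simp: bdd_above_nat)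
    then show ?thesis
      using False by (intro cSup_least)
  qed simp
  show ?thesis
  proof (cases "finite A")
    case True
    then have "finite B"
      using inf[of B A] BA by blast
    then have "Sup A \<le> Sup B + \<epsilon>" "Sup B \<le> Sup A + \<epsilon>"
      using fin[of A B] fin[of B A] AB BA True by blast+
    then show ?thesis
      by linarith
  next
    case False
    then have "infinite B"
      using inf[of A B] AB by blast
    then show ?thesis
      using False by (auto simp: Sup_nat_def Max.infinite)
  qed
qed

theorem theorem4p9:
  fixes K :: "('k, 'm) ring_scheme"
    and M :: "(int \<times> int, 'k, 'v) pmod"
    and N :: "(int \<times> int, 'k, 'w) pmod"
  assumes "field K"
    and "extended_zigzag_module K M"
    and "extended_zigzag_module K N"
  shows "landscape_dist K M N \<le> ezz_interleaving_dist K M N"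
proof -
  have M: "ezz_diagram K M" and N: "ezz_diagram K N"
    using assms(2,3) by (auto simp: extended_zigzag_module_def ezz_diagram_def vec_diagram_def)
  \<comment> \<open>If the rank of one module on the square of radius
    \<open>r \<ge> \<epsilon>\<close> is at least \<open>k\<close>, so is that of the other on
    radius \<open>r - \<epsilon>\<close>. With the symmetric statement this is the hypothesis of
    \<open>Sup_nat_shift_le\<close>.\<close>
  have "\<bar>landscape K M k x - landscape K N k x\<bar> \<le> real \<epsilon>"
    if "interleaved K (- int \<epsilon>, int \<epsilon>, int \<epsilon>) (ext_block_ext K M) (ext_block_ext K N)" for \<epsilon> k x
    unfolding landscape_def
    using gen_rank_le_of_interleaved[OF M N that, of _ x]
      gen_rank_le_of_interleaved[OF N M interleaved_sym[OF that], of _ x]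
    by (intro Sup_nat_shift_le) (auto intro: order_trans)
  \<comment> \<open>Every admissible \<open>\<epsilon>\<close> bounds all differences, so the
    supremum is below the infimum. Without any interleaving the infimum is over the empty set and
    equals infinity.\<close>
  then show ?thesis
    unfolding landscape_dist_def ezz_interleaving_dist_def interleaving_dist_def
    by (auto intro!: SUP_least INF_greatest)
qed

end
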